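(* Let $C/\mathbb Q$ be the affine curve defined by $y^2=2(x^3+x^2-x+1)$, $z^2=2x(x^3+x^2+x-1)$. Then: (1) $C(\mathbb Q)=\{(\pm1,\pm2,\pm2)\}$ (all sign choices); (2) if $K$ is a quadratic field different from $\mathbb Q(\sqrt2)$ and $\mathbb Q(\sqrt{17})$, then $C(K)=C(\mathbb Q)$; (3) for $K=\mathbb Q(\sqrt2)$, $C(K)\setminus C(\mathbb Q)=\{(0,\pm\sqrt2,0)\}$; (4) for $K=\mathbb Q(\sqrt{17})$, $C(K)\setminus C(\mathbb Q)=\{(x,\pm(4x+2),\pm(12x+2)): x^2-8x-1=0\}$.
   Context: For a field $K\supseteq\mathbb Q$, $C(K)$ denotes the set of triples $(x,y,z)\in K^3$ satisfying both equations. *)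

theory Defs
  imports Complex_Main "HOL-Algebra.Generated_Fields" "HOL-Algebra.Algebraic_Closure_Type"
begin

definition curve_points :: "'a::field_char_0 set \<Rightarrow> ('a \<times> 'a \<times> 'a) set" where
  "curve_points K = {(x, y, z). x \<in> K \<and> y \<in> K \<and> z \<in> K \<and>
     y ^ 2 = 2 * (x ^ 3 + x ^ 2 - x + 1) \<and>
     z ^ 2 = 2 * x * (x ^ 3 + x ^ 2 + x - 1)}"

text \<open>Fields are subfields of an ambient field of characteristic 0, which is a type; an abstract
  field \<open>K\<close> is covered by taking \<open>K = UNIV\<close>. The set \<open>\<rat>\<close> is the copy of the rationals in the
  ambient field, and \<^const>\<open>ring_of_type_algebra\<close> is the ambient field as a HOL-Algebra
  ring.\<close>

definition quadratic_field :: "'a::field_char_0 set \<Rightarrow> bool" where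
  "quadratic_field K \<longleftrightarrow>
     subfield K (ring_of_type_algebra :: 'a ring) \<and>
     ring.dimension (ring_of_type_algebra :: 'a ring) 2 \<rat> K"

text \<open>A generated field contains 1, hence \<open>\<rat>\<close>, so this is \<open>\<rat>(a)\<close>.\<close>

definition rat_adjoin :: "'a::field_char_0 \<Rightarrow> 'a set" where
  "rat_adjoin a = generate_field (ring_of_type_algebra :: 'a ring) {a}"

end

theory Submission
  imports Defs
begin

text \<open>Both \<open>(x, y)\<close> and \<open>(-1/x, z/x\<^sup>2)\<close> lie on \<open>E: y\<^sup>2 = 2 (x\<^sup>3 + x\<^sup>2 - x + 1)\<close>, a model of
  \<open>X\<^sub>1(11)\<close> whose affine rational points have \<open>x = 1\<close> or \<open>x = -1\<close>; this is an infinite \<open>2\<close>-descent in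
  \<open>\<int>[\<tau>]\<close>, \<open>\<tau>\<^sup>3 = \<tau>\<^sup>2 + \<tau> + 1\<close>, which is norm-Euclidean with unit group \<open>\<plusminus>\<tau>\<^sup>k\<close>.

  If \<open>x\<close> is quadratic irrational with minimal polynomial \<open>X\<^sup>2 + p X + q\<close>, the line through \<open>(x, y)\<close>
  and its conjugate meets \<open>E\<close> in a third rational point, which gives an equation between \<open>p\<close> and \<open>q\<close>.
  The point over \<open>-1/x\<close> gives a second one, and together they leave only \<open>X\<^sup>2 - 8 X - 1\<close>.

  If \<open>x\<close> is rational and neither \<open>y\<close> nor \<open>z\<close> is, then \<open>y\<close> and \<open>z\<close> are rational multiples of the same
  square root. Comparing common factors, \<open>K\<close> would have to be \<open>\<rat>(\<surd>2)\<close> and \<open>x\<close> or \<open>-1/x\<close> the abscissa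
  of a rational point on \<open>y\<^sup>2 = x\<^sup>3 + x\<^sup>2 + x - 1\<close>; a second descent in \<open>\<int>[\<tau>]\<close> shows that there is none.\<close>

section \<open>The ring \<open>\<int>[\<tau>]\<close>\<close>

text \<open>One cubic ring serves both descents because the two cubics have the roots -\<tau> and
  1/\<tau>, which x -> -1/x exchanges. With cleared denominators each right-hand side is the norm of
  some a + b \<kappa> with a and b coprime. If this norm is a square, then a + b \<kappa> is a
  square up to a unit and a divisor of an element whose norm divides 176 = 16 * 11. That divisor has
  square norm too, so 11 drops out and only an even power of the ramified prime above 2 is left. Of
  the unit classes, positivity of the norm keeps 1 and \<tau>, and a parity or mod 4 argument
  removes \<tau>. A vanishing combination of coordinates of the square is then a conic, whose
  parametrisation leads to a smaller point. The two descents end differently. E has five rational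
  points, a group of odd order, so each of them is again twice a rational point and the halving
  alone never stops: an explicit size estimate must show a strict decrease outside a finite list of
  parameters. The second curve has no affine rational point, and there the denominator simply keeps
  shrinking.\<close>

text \<open>\<open>Trib a b c\<close> stands for \<open>a + b \<tau> + c \<tau>\<^sup>2\<close> with \<open>\<tau>\<^sup>3 = \<tau>\<^sup>2 + \<tau> + 1\<close>.\<close>

datatype trib = Trib int int int

instantiation trib :: comm_ring_1
begin

definition "0 = Trib 0 0 0"
definition "1 = Trib 1 0 0"

fun plus_trib where
  "Trib a b c + Trib a' b' c' = Trib (a + a') (b + b') (c + c')"
fun minus_trib where
  "Trib a b c - Trib a' b' c' = Trib (a - a') (b - b') (c - c')"
fun uminus_trib where
  "- Trib a b c = Trib (- a) (- b) (- c)"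
fun times_trib where
  "Trib a b c * Trib a' b' c' =
     Trib (a * a' + b * c' + c * b' + c * c')
          (a * b' + b * a' + b * c' + c * b' + 2 * (c * c'))
          (a * c' + b * b' + c * a' + b * c' + c * b' + 2 * (c * c'))"

instance
proof
  fix x y z :: trib
  show "x * y * z = x * (y * z)"
    by (cases x; cases y; cases z) (simp add: algebra_simps)
  show "x * y = y * x"
    by (cases x; cases y) (simp add: algebra_simps)
  show "1 * x = x" by (cases x) (simp add: one_trib_def)
  show "x + y + z = x + (y + z)" by (cases x; cases y; cases z) simp
  show "x + y = y + x" by (cases x; cases y) simp
  show "0 + x = x" by (cases x) (simp add: zero_trib_def)
  show "- x + x = 0" by (cases x) (simp add: zero_trib_def)
  show "x - y = x + - y" by (cases x; cases y) simp
  show "(x + y) * z = x * z + y * z"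
    by (cases x; cases y; cases z) (simp add: algebra_simps)
  show "(0 :: trib) \<noteq> 1" by (simp add: zero_trib_def one_trib_def)
qed

end

definition tau :: trib where "tau = Trib 0 1 0"

lemma trib_of_int: "of_int n = Trib n 0 0"
proof (induction n rule: int_induct[where k = 0])
  case base
  then show ?case by (simp add: zero_trib_def)
qed (simp_all add: one_trib_def)

fun nrm :: "trib \<Rightarrow> int" where
  "nrm (Trib a b c) = a^3 + a^2*b + 3*a^2*c - a*b^2 - 4*a*b*c - a*c^2 + b^3 + b^2*c - b*c^2 + c^3"

text \<open>\<open>adj x\<close> is the product of the two other conjugates of \<open>x\<close>.\<close>

fun adj :: "trib \<Rightarrow> trib" where
  "adj (Trib a b c) = Trib ((a + c) * (a + b + 2 * c) - (b + 2 * c) * (b + c))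
     (c * (b + 2 * c) - b * (a + b + 2 * c)) (b * (b + c) - c * (a + c))"

lemma mult_adj: "x * adj x = of_int (nrm x)"
  by (cases x) (simp add: trib_of_int algebra_simps power2_eq_square power3_eq_cube)

lemma of_int_trib_cancel: "of_int m = (of_int n :: trib) \<longleftrightarrow> m = n"
  by (simp add: trib_of_int)

lemma adj_mult: "adj (x * y) = adj x * adj y"
  by (cases x; cases y) (simp add: algebra_simps)

lemma nrm_mult: "nrm (x * y) = nrm x * nrm y"
proof -
  have "of_int (nrm (x * y)) = x * y * adj (x * y)"
    by (rule mult_adj[symmetric])
  also have "\<dots> = (x * adj x) * (y * adj y)"
    by (simp add: adj_mult mult_ac)
  also have "\<dots> = of_int (nrm x * nrm y)"
    by (simp add: mult_adj)
  finally show ?thesis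
    by (simp only: of_int_trib_cancel)
qed

lemma nrm_0_1 [simp]: "nrm 0 = 0" "nrm 1 = 1"
  by (simp_all add: zero_trib_def one_trib_def)

lemma nrm_uminus: "nrm (- x) = - nrm x"
  by (cases x) simp

lemma nrm_of_int: "nrm (of_int n) = n ^ 3"
  by (simp add: trib_of_int)

text \<open>The prime \<open>\<tau> - 1\<close> above \<open>2\<close>, which is totally ramified.\<close>

definition pi2 :: trib where "pi2 = tau - 1"

lemma pi2_eq: "pi2 = Trib (-1) 1 0"
  by (simp add: pi2_def tau_def one_trib_def)

lemma nrm_pi2: "nrm pi2 = 2" and nrm_tau: "nrm tau = 1"
  by (simp_all add: pi2_eq tau_def)

text \<open>Modulo 2 the norm is a + b + c, the value at \<tau> = 1, so an even norm already makes
  \<open>pi2\<close> a divisor. Total ramification enters the proof in this form.\<close>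

lemma pi2_dvd:
  assumes "even (nrm x)"
  obtains y where "x = pi2 * y" "nrm x = 2 * nrm y"
proof -
  obtain a b c where x: "x = Trib a b c" by (cases x)
  have "even (a + b + c)"
    using assms unfolding x by (cases "even a"; cases "even b"; cases "even c") simp_all
  then obtain k where k: "a + b + c = 2 * k" by (elim evenE)
  have "x = pi2 * Trib (k - a) c k"
    unfolding x pi2_eq using k by simp
  then show ?thesis using that nrm_mult nrm_pi2 by metis
qed

text \<open>Descent replaces irreducibility of the cubic: a zero norm stays even after each division
  by \<open>pi2\<close>, so \<open>pi2 ^ 3\<close>, an associate of 2, divides x, and halving x
  shrinks its coordinates.\<close>

lemma nrm_eq_0_iff [simp]: "nrm x = 0 \<longleftrightarrow> x = 0"
proof
  define sz where "sz = (\<lambda>x. case x of Trib a b c \<Rightarrow> nat (\<bar>a\<bar> + \<bar>b\<bar> + \<bar>c\<bar>))"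
  show "nrm x = 0 \<Longrightarrow> x = 0"
  proof (induction x rule: measure_induct_rule[where f = sz])
    case (less x)
    have step: "\<exists>v. u = pi2 * v \<and> nrm v = 0" if u: "nrm u = 0" for u
    proof -
      have "even (nrm u)" using u by simp
      then obtain v where "u = pi2 * v" "nrm u = 2 * nrm v" by (rule pi2_dvd)
      with u show ?thesis by auto
    qed
    from step[OF less.prems] obtain y where y: "x = pi2 * y" "nrm y = 0" by blast
    from step[OF y(2)] obtain z where z: "y = pi2 * z" "nrm z = 0" by blast
    from step[OF z(2)] obtain w where w: "z = pi2 * w" "nrm w = 0" by blast
    have cube: "pi2 * (pi2 * pi2) = 2 * Trib 0 2 (-1)"
      unfolding pi2_eq mult_2 by simp
    define v where "v = Trib 0 2 (-1) * w"
    have x: "x = 2 * v"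
    proof -
      have "x = pi2 * (pi2 * pi2) * w"
        unfolding y(1) z(1) w(1) by (simp only: mult.assoc)
      then show ?thesis
        unfolding cube v_def by (simp only: mult.assoc)
    qed
    obtain a b c where v: "v = Trib a b c" by (cases v)
    have x': "x = Trib (2 * a) (2 * b) (2 * c)"
      unfolding x v mult_2[of "Trib a b c"] by simp
    show ?case
    proof (rule ccontr)
      assume "x \<noteq> 0"
      then have "a \<noteq> 0 \<or> b \<noteq> 0 \<or> c \<noteq> 0"
        unfolding x' zero_trib_def by simp
      then have "sz v < sz x"
        unfolding x' v sz_def by simp linarith
      moreover have "nrm v = 0" unfolding v_def using w by (simp add: nrm_mult)
      ultimately have "v = 0" by (rule less.IH)
      with x \<open>x \<noteq> 0\<close> show False by simp
    qed
  qed
qed simp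

instance trib :: idom
proof
  fix x y :: trib
  assume "x \<noteq> 0" "y \<noteq> 0"
  then have "nrm (x * y) \<noteq> 0" by (simp add: nrm_mult)
  then show "x * y \<noteq> 0" by auto
qed

section \<open>Norm-Euclidean division\<close>

text \<open>The tribonacci constant 1.8392...; the interval is narrow enough for all numerical
  estimates below.\<close>

definition trc :: real where
  "trc = (SOME t. 1839 / 1000 \<le> t \<and> t \<le> 46 / 25 \<and> t ^ 3 = t ^ 2 + t + 1)"

lemma trc: "1839 / 1000 \<le> trc" "trc \<le> 46 / 25" "trc ^ 3 = trc ^ 2 + trc + 1"
proof -
  have "\<exists>t. 1839 / 1000 \<le> t \<and> t \<le> 46 / 25 \<and> t ^ 3 - t ^ 2 - t = (1 :: real)"
    by (rule IVT) (auto simp: power2_eq_square power3_eq_cube intro!: continuous_intros)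
  then have "\<exists>t. 1839 / 1000 \<le> t \<and> t \<le> 46 / 25 \<and> t ^ 3 = t ^ 2 + t + (1 :: real)"
    by (auto simp: algebra_simps)
  from someI_ex[OF this] show "1839 / 1000 \<le> trc" "trc \<le> 46 / 25" "trc ^ 3 = trc ^ 2 + trc + 1"
    unfolding trc_def by auto
qed

lemma trc2: "3381 / 1000 \<le> trc ^ 2" "trc ^ 2 \<le> 1693 / 500"
  using power_mono[OF trc(1), of 2] power_mono[OF trc(2), of 2] trc(1)
  by (simp_all add: power2_eq_square)

lemma trc_power4: "trc ^ 4 = 2 * trc ^ 2 + 2 * trc + 1"
proof -
  have "trc ^ 4 = trc ^ 3 * trc" by (simp add: numeral_eq_Suc)
  also have "\<dots> = (trc ^ 2 + trc + 1) * trc" by (simp only: trc(3))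
  also have "\<dots> = trc ^ 3 + trc ^ 2 + trc" by (simp add: algebra_simps power2_eq_square power3_eq_cube)
  finally show ?thesis using trc(3) by simp
qed

text \<open>\<open>rE\<close> is the real embedding and \<open>rQ\<close> the squared modulus of the complex one, both extended
  linearly to real coordinates.\<close>

definition rE :: "real \<Rightarrow> real \<Rightarrow> real \<Rightarrow> real" where
  "rE a b c = a + b * trc + c * trc ^ 2"

definition rQ :: "real \<Rightarrow> real \<Rightarrow> real \<Rightarrow> real" where
  "rQ a b c = rE ((a + c) * (a + b + 2 * c) - (b + 2 * c) * (b + c))
     (c * (b + 2 * c) - b * (a + b + 2 * c)) (b * (b + c) - c * (a + c))"

definition rN :: "real \<Rightarrow> real \<Rightarrow> real \<Rightarrow> real" where
  "rN a b c = a^3 + a^2*b + 3*a^2*c - a*b^2 - 4*a*b*c - a*c^2 + b^3 + b^2*c - b*c^2 + c^3"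

lemma rE_mult: "rE a b c * rE a' b' c' =
  rE (a * a' + b * c' + c * b' + c * c')
          (a * b' + b * a' + b * c' + c * b' + 2 * (c * c'))
          (a * c' + b * b' + c * a' + b * c' + c * b' + 2 * (c * c'))"
proof -
  have "rE a b c * rE a' b' c' = a * a' + (a * b' + b * a') * trc + (a * c' + b * b' + c * a') * trc ^ 2
     + (b * c' + c * b') * trc ^ 3 + c * c' * trc ^ 4"
    by (simp add: rE_def algebra_simps eval_nat_numeral)
  then show ?thesis unfolding trc(3) trc_power4 rE_def by Groebner_Basis.algebra
qed

lemma rE_mult_rQ: "rE a b c * rQ a b c = rN a b c"
  unfolding rQ_def rE_mult unfolding rE_def rN_def by Groebner_Basis.algebra

lemma rQ_nonneg: "rQ a b c \<ge> 0"
proof -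
  \<comment> \<open>\<open>r\<close> is the real part of a complex root and \<open>W\<close> its
    squared imaginary part: the three roots have sum 1 and product 1, so the complex pair has sum 1
    - trc and product 1 / trc = trc^2 - trc - 1.\<close>
  define r where "r = (1 - trc) / 2"
  define W where "W = trc ^ 2 - trc - 1 - r ^ 2"
  have r2: "r ^ 2 = (1 - 2 * trc + trc ^ 2) / 4"
    unfolding r_def by (simp add: power2_eq_square field_simps)
  have W0: "W \<ge> 0" unfolding W_def r2 using trc trc2 by simp
  have t: "trc = 1 - 2 * r" unfolding r_def by simp
  have "rQ a b c = (a + b * r + c * (r ^ 2 - W)) ^ 2 + W * (b + 2 * c * r) ^ 2"
    using trc(3) t unfolding W_def rQ_def rE_def by Groebner_Basis.algebra
  with W0 show ?thesis by simp
qed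

text \<open>\<open>rS\<close> is the sum of the squared absolute values of the three conjugates, so that the AM-GM
  inequality bounds the norm by it. Being positive definite, it can be diagonalised approximately
  (with a rational change of variables) and made small by rounding one coordinate after another.\<close>

definition rS :: "real \<Rightarrow> real \<Rightarrow> real \<Rightarrow> real" where
  "rS a b c = rE a b c ^ 2 + 2 * rQ a b c"

text \<open>This completes the square in \<open>a\<close>; the traces of 1, \<tau>, \<tau>^2 are 3,
  1, 3.\<close>

lemma rS_eq: "rS a b c = 3 * (a + b / 3 + c) ^ 2 + (3 * trc ^ 2 - 2 * trc - 7 / 3) * b ^ 2
    + (4 * trc ^ 2 - 4) * (b * c) + (6 * trc - 2) * c ^ 2"
proof -
  have 1: "3 * (a + b / 3 + c) ^ 2 = 3 * a^2 + b^2/3 + 3 * c^2 + 2 * (a * b) + 2 * (b * c) + 6 * (a * c)"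
    by (simp add: power2_eq_square algebra_simps)
  have 2: "(3 * trc ^ 2 - 2 * trc - 7 / 3) * b ^ 2 = (3 * trc ^ 2 - 2 * trc - 2) * b ^ 2 - b ^ 2 / 3"
    by (simp add: algebra_simps)
  show ?thesis
    unfolding 1 2 rS_def power2_eq_square[of "rE a b c"] rE_mult rQ_def unfolding rE_def
    by (simp add: algebra_simps power2_eq_square)
qed

lemma rS_diagonal:
  obtains p q s :: real where
    "41 / 10 \<le> p" "p \<le> 83 / 20" "\<bar>q\<bar> \<le> 1 / 20" "7 / 2 \<le> s" "s \<le> 18 / 5"
    "\<And>a b c y. y = b + 23 / 20 * c \<Longrightarrow>
       rS a b c = 3 * (a + b / 3 + c) ^ 2 + p * y ^ 2 + q * (y * c) + s * c ^ 2"
proof -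
  \<comment> \<open>23/20 approximates the irrational ratio that would complete the square in
    \<open>b\<close> exactly; \<open>q\<close> is the small cross term left over.\<close>
  define p q s where "p = 3 * trc ^ 2 - 2 * trc - 7 / 3"
    and "q = 41 / 30 + 23 / 5 * trc - 29 / 10 * trc ^ 2"
    and "s = - 583 / 1200 + 671 / 200 * trc - 253 / 400 * trc ^ 2"
  have "rS a b c = 3 * (a + b / 3 + c) ^ 2 + p * y ^ 2 + q * (y * c) + s * c ^ 2"
    if y: "y = b + 23 / 20 * c" for a b c y
  proof -
    have 1: "P * b ^ 2 + Q * (b * c) = P * y ^ 2 + (Q - 23 / 10 * P) * (y * c) + (529 / 400 * P - 23 / 20 * Q) * c ^ 2"
      for P Q :: real
      using y by Groebner_Basis.algebra
    have q: "(4 * trc ^ 2 - 4) - 23 / 10 * p = q"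
      unfolding q_def p_def by (simp add: field_simps)
    have s: "529 / 400 * p - 23 / 20 * (4 * trc ^ 2 - 4) = s - (6 * trc - 2)"
      unfolding s_def p_def by (simp add: field_simps)
    have "rS a b c = 3 * (a + b / 3 + c) ^ 2 + (p * b ^ 2 + (4 * trc ^ 2 - 4) * (b * c)) + (6 * trc - 2) * c ^ 2"
      unfolding rS_eq p_def by (simp only: add.assoc)
    also have "p * b ^ 2 + (4 * trc ^ 2 - 4) * (b * c) = p * y ^ 2 + q * (y * c) + (s - (6 * trc - 2)) * c ^ 2"
      unfolding 1 q s ..
    finally show ?thesis by (simp only: left_diff_distrib)
  qed
  moreover have "41 / 10 \<le> p" "p \<le> 83 / 20"
    unfolding p_def using trc trc2 by linarith+
  moreover have "\<bar>q\<bar> \<le> 1 / 20"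
    unfolding q_def abs_le_iff using trc trc2 by linarith
  moreover have "7 / 2 \<le> s" "s \<le> 18 / 5"
    unfolding s_def using trc trc2 by linarith+
  ultimately show ?thesis using that by blast
qed

lemma rN_rS: "27 * rN a b c ^ 2 \<le> rS a b c ^ 3"
proof -
  define e q where "e = rE a b c ^ 2" and "q = rQ a b c"
  have eq: "e \<ge> 0" "q \<ge> 0" unfolding e_def q_def using rQ_nonneg by auto
  have "(e + 2 * q) ^ 3 - 27 * (e * q ^ 2) = (e - q) ^ 2 * (e + 8 * q)"
    by (simp add: algebra_simps power2_eq_square power3_eq_cube)
  also have "\<dots> \<ge> 0" using eq by simp
  finally have "27 * (e * q ^ 2) \<le> (e + 2 * q) ^ 3" by simp
  then show ?thesis
    unfolding rS_def e_def q_def rE_mult_rQ[symmetric] power_mult_distrib .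
qed

lemma abs_mult_le_half_squares: "\<bar>y * c\<bar> \<le> (y ^ 2 + c ^ 2) / (2 :: real)"
  using zero_le_power2[of "y - c"] zero_le_power2[of "y + c"]
  by (simp add: abs_le_iff power2_eq_square algebra_simps)

text \<open>The four terms contribute at most 3/4 + 83/80 + 1/80 + 9/10 = 27/10. Anything below 3 is
  good enough, because 27 N^2 <= S^3 then gives N^2 < 1.\<close>

lemma rS_upper:
  assumes "\<bar>a + b / 3 + c\<bar> \<le> 1 / 2" "\<bar>b + 23 / 20 * c\<bar> \<le> 1 / 2" "\<bar>c\<bar> \<le> 1 / 2"
  shows "rS a b c \<le> 27 / 10"
proof -
  define y where "y = b + 23 / 20 * c"
  have half: "x ^ 2 \<le> 1 / 4" if "\<bar>x\<bar> \<le> 1 / 2" for x :: real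
    using power_mono[OF that, of 2] by (simp add: power_divide)
  note sq = half[OF assms(1)] half[OF assms(2), folded y_def] half[OF assms(3)]
  have yc: "\<bar>y * c\<bar> \<le> 1 / 4" using abs_mult_le_half_squares[of y c] sq by simp
  obtain p q s where pqs: "41 / 10 \<le> p" "p \<le> 83 / 20" "\<bar>q\<bar> \<le> 1 / 20" "7 / 2 \<le> s" "s \<le> 18 / 5"
    and *: "\<And>a b c y. y = b + 23 / 20 * c \<Longrightarrow>
       rS a b c = 3 * (a + b / 3 + c) ^ 2 + p * y ^ 2 + q * (y * c) + s * c ^ 2"
    by (rule rS_diagonal) (rule that)
  note S = *[OF y_def, of a]
  have "p * y ^ 2 \<le> 83 / 20 * (1 / 4)" "s * c ^ 2 \<le> 18 / 5 * (1 / 4)"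
    using pqs sq by (intro mult_mono; simp)+
  moreover have "\<bar>q * (y * c)\<bar> \<le> 1 / 20 * (1 / 4)"
    unfolding abs_mult[of q] using pqs yc by (intro mult_mono; simp)
  ultimately show ?thesis
    unfolding S using sq(1) by linarith
qed

text \<open>Meant for the enumeration of units. Splitting the cross term evenly costs 1/40 in the
  coefficients of y^2 and c^2.\<close>

lemma rS_lower:
  "rS a b c \<ge> 3 * (a + b / 3 + c) ^ 2 + 407 / 100 * (b + 23 / 20 * c) ^ 2 + 347 / 100 * c ^ 2"
proof -
  define y where "y = b + 23 / 20 * c"
  obtain p q s where pqs: "41 / 10 \<le> p" "p \<le> 83 / 20" "\<bar>q\<bar> \<le> 1 / 20" "7 / 2 \<le> s" "s \<le> 18 / 5"
    and *: "\<And>a b c y. y = b + 23 / 20 * c \<Longrightarrow>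
       rS a b c = 3 * (a + b / 3 + c) ^ 2 + p * y ^ 2 + q * (y * c) + s * c ^ 2"
    by (rule rS_diagonal) (rule that)
  note S = *[OF y_def, of a]
  have "41 / 10 * y ^ 2 \<le> p * y ^ 2" "7 / 2 * c ^ 2 \<le> s * c ^ 2"
    using pqs by (intro mult_right_mono; simp)+
  moreover have "q * (y * c) \<ge> - (y ^ 2 / 40) - c ^ 2 / 40"
  proof -
    have "\<bar>q * (y * c)\<bar> \<le> 1 / 20 * ((y ^ 2 + c ^ 2) / 2)"
      unfolding abs_mult[of q] using pqs abs_mult_le_half_squares[of y c] by (intro mult_mono; simp)
    also have "\<dots> = y ^ 2 / 40 + c ^ 2 / 40" by simp
    finally show ?thesis by linarith
  qed
  moreover have "y ^ 2 \<ge> 0" "c ^ 2 \<ge> 0" by simp_all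
  moreover have "x + y' + q * (y * c) + z' \<ge> x + 407 / 100 * y ^ 2 + 347 / 100 * c ^ 2"
    if "41 / 10 * y ^ 2 \<le> y'" "7 / 2 * c ^ 2 \<le> z'" "q * (y * c) \<ge> - (y ^ 2 / 40) - c ^ 2 / 40"
      "y ^ 2 \<ge> 0" "c ^ 2 \<ge> 0" for x y' z' :: real
    using that by linarith
  ultimately show ?thesis
    unfolding S y_def[symmetric] by blast
qed

lemma exists_rounding:
  fixes a b c :: real
  obtains i j k :: int where "\<bar>rN (a - i) (b - j) (c - k)\<bar> < 1"
proof -
  define k j where "k = round c" and "j = round (b + 23 / 20 * (c - k))"
  define i where "i = round (a + (b - j) / 3 + (c - k))"
  have r: "\<bar>x - of_int (round x)\<bar> \<le> 1 / 2" for x :: real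
    using of_int_round_abs_le[of x] by (simp add: abs_minus_commute)
  have "rS (a - i) (b - j) (c - k) \<le> 27 / 10"
  proof (rule rS_upper)
    show "\<bar>c - k\<bar> \<le> 1 / 2" unfolding k_def by (rule r)
    show "\<bar>b - j + 23 / 20 * (c - k)\<bar> \<le> 1 / 2"
      using r[of "b + 23 / 20 * (c - k)"] unfolding j_def by (simp add: algebra_simps)
    show "\<bar>a - i + (b - j) / 3 + (c - k)\<bar> \<le> 1 / 2"
      using r[of "a + (b - j) / 3 + (c - k)"] unfolding i_def by (simp add: algebra_simps)
  qed
  moreover have "rS (a - i) (b - j) (c - k) \<ge> 0"
    unfolding rS_def using rQ_nonneg by simp
  ultimately have "rS (a - i) (b - j) (c - k) ^ 3 \<le> (27 / 10) ^ 3"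
    by (rule power_mono)
  then have "rN (a - i) (b - j) (c - k) ^ 2 < 1"
    using rN_rS[of "a - i" "b - j" "c - k"] by (simp add: power3_eq_cube)
  then show ?thesis
    using that by (simp add: abs_square_less_1)
qed

lemma trib_division:
  assumes "y \<noteq> 0"
  obtains q where "\<bar>nrm (x - q * y)\<bar> < \<bar>nrm y\<bar>"
proof -
  obtain u v w where uvw: "x * adj y = Trib u v w" by (cases "x * adj y")
  define n where "n = nrm y"
  have n: "n \<noteq> 0" using assms unfolding n_def by simp
  obtain i j k :: int where ijk: "\<bar>rN (u / n - i) (v / n - j) (w / n - k)\<bar> < 1"
    by (rule exists_rounding)
  define q where "q = Trib i j k"
  have rN_of_int: "rN (of_int a) (of_int b) (of_int c) = of_int (nrm (Trib a b c))" for a b c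
    unfolding rN_def by simp
  have rN_scale: "rN (t * a) (t * b) (t * c) = t ^ 3 * rN a b c" for t a b c
    unfolding rN_def by (simp add: algebra_simps power2_eq_square power3_eq_cube)
  \<comment> \<open>Multiplying by \<open>adj y\<close>, of norm n^2, turns the remainder into the
    rounding error of x * adj y / n scaled by n.\<close>
  have "nrm (x - q * y) * n ^ 2 = nrm ((x - q * y) * adj y)"
  proof -
    have "n * nrm (adj y) = n ^ 3"
      unfolding n_def by (simp add: nrm_mult[symmetric] mult_adj nrm_of_int)
    then have "nrm (adj y) = n ^ 2"
      using n by (simp add: power2_eq_square power3_eq_cube)
    then show ?thesis by (simp add: nrm_mult)
  qed
  also have "(x - q * y) * adj y = x * adj y - of_int n * q"
    unfolding n_def mult_adj[symmetric] by (simp add: algebra_simps)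
  also have "\<dots> = Trib (u - n * i) (v - n * j) (w - n * k)"
    unfolding uvw q_def trib_of_int by simp
  finally have "real_of_int (nrm (x - q * y) * n ^ 2) =
      rN (of_int (u - n * i)) (of_int (v - n * j)) (of_int (w - n * k))"
    unfolding rN_of_int by simp
  also have "\<dots> = rN (n * (u / n - i)) (n * (v / n - j)) (n * (w / n - k))"
    using n by (simp add: field_simps)
  also have "\<dots> = real_of_int n ^ 3 * rN (u / n - i) (v / n - j) (w / n - k)"
    by (rule rN_scale)
  finally have eq: "real_of_int (nrm (x - q * y)) = n * rN (u / n - i) (v / n - j) (w / n - k)"
    using n by (simp add: power2_eq_square power3_eq_cube)
  have "\<bar>real_of_int (nrm (x - q * y))\<bar> < \<bar>real_of_int n\<bar> * 1"
    unfolding eq abs_mult using ijk n by (intro mult_strict_left_mono) auto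
  then have "\<bar>nrm (x - q * y)\<bar> < \<bar>nrm y\<bar>"
    unfolding n_def by linarith
  then show ?thesis by (rule that)
qed

lemma trib_bezout:
  obtains g p q where "g dvd x" "g dvd (y :: trib)" "g = p * x + q * y"
proof -
  have "\<exists>g p q. g dvd x \<and> g dvd y \<and> g = p * x + q * y"
  proof (induction y arbitrary: x rule: measure_induct_rule[where f = "\<lambda>y. nat \<bar>nrm y\<bar>"])
    case (less y x)
    show ?case
    proof (cases "y = 0")
      case True
      then show ?thesis by (intro exI[of _ x] exI[of _ 1] exI[of _ 0]) simp
    next
      case False
      then obtain k where k: "\<bar>nrm (x - k * y)\<bar> < \<bar>nrm y\<bar>" by (rule trib_division)
      then have "nat \<bar>nrm (x - k * y)\<bar> < nat \<bar>nrm y\<bar>" using False by simp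
      from less.IH[OF this, of y] obtain g p q
        where g: "g dvd y" "g dvd x - k * y" "g = p * y + q * (x - k * y)" by blast
      have "g dvd (x - k * y) + k * y"
        using g(1,2) by (intro dvd_add) auto
      then have "g dvd x" by simp
      moreover have "g = q * x + (p - q * k) * y"
        using g(3) by (simp add: algebra_simps)
      ultimately show ?thesis using g(1) by blast
    qed
  qed
  then show ?thesis using that by blast
qed

section \<open>Units and squares\<close>

fun emb :: "trib \<Rightarrow> real" where
  "emb (Trib a b c) = rE a b c"

lemma emb_mult: "emb (x * y) = emb x * emb y"
  by (cases x; cases y) (simp add: rE_mult)

lemma emb_1: "emb 1 = 1"
  by (simp add: one_trib_def rE_def)

lemma emb_power: "emb (x ^ n) = emb x ^ n"
  by (induction n) (simp_all add: emb_1 emb_mult)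

lemma emb_nonzero:
  assumes "nrm u \<noteq> 0" shows "emb u \<noteq> 0"
proof
  assume "emb u = 0"
  then have "emb (of_int (nrm u)) = 0" unfolding mult_adj[symmetric] emb_mult by simp
  with assms show False by (simp add: trib_of_int rE_def)
qed

definition itau :: trib where "itau = Trib (-1) (-1) 1"

lemma tau_itau: "tau * itau = 1" "itau * tau = 1"
  by (simp_all add: tau_def itau_def one_trib_def)

lemma emb_tau: "emb tau = trc"
  by (simp add: tau_def rE_def)

lemma emb_itau: "emb itau = inverse trc"
proof -
  have "emb tau * emb itau = 1"
    by (simp only: emb_mult[symmetric] tau_itau emb_1)
  then show ?thesis
    using trc(1) by (simp add: emb_tau field_simps)
qed

text \<open>The hypothesis is the bound of \<open>rS_lower\<close> for rS <= 9/2, multiplied by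
  1200, with 407/100 weakened to 4. The triples are 0 and, up to sign, 1, \<tau> and
  1/\<tau>.\<close>

lemma small_coefficients:
  fixes a b c :: int
  assumes "400 * (3 * a + b + 3 * c) ^ 2 + 12 * (20 * b + 23 * c) ^ 2 + 4164 * c ^ 2 \<le> 5400"
  shows "(a, b, c) \<in> {(0,0,0), (1,0,0), (-1,0,0), (0,1,0), (0,-1,0), (-1,-1,1), (1,1,-1)}"
proof -
  have sq: "\<bar>x\<bar> < y" if "x ^ 2 < y ^ 2" "y > 0" for x y :: int
    using that by (metis abs_le_square_iff abs_of_pos linorder_not_le)
  define m n where "m = 3 * a + b + 3 * c" and "n = 20 * b + 23 * c"
  have *: "400 * m ^ 2 + 12 * n ^ 2 + 4164 * c ^ 2 \<le> 5400"
    using assms unfolding m_def n_def .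
  have nonneg: "m ^ 2 \<ge> 0" "n ^ 2 \<ge> 0" "c ^ 2 \<ge> 0" by simp_all
  have "c ^ 2 < 2 ^ 2" using * nonneg by (simp; linarith)
  then have c: "\<bar>c\<bar> < 2" by (rule sq) simp
  have "m ^ 2 < 4 ^ 2" using * nonneg by (simp; linarith)
  then have m: "\<bar>m\<bar> < 4" by (rule sq) simp
  consider "c = 0" | "c = 1" | "c = -1" using c by linarith
  then show ?thesis
  proof cases
    case 1
    have "n ^ 2 < 22 ^ 2" using * nonneg by (simp; linarith)
    then have "\<bar>n\<bar> < 22" by (rule sq) simp
    then have "b = 0 \<or> b = 1 \<or> b = -1" unfolding n_def using 1 by linarith
    moreover have "a = 0" if "b = 1 \<or> b = -1"
    proof -
      have "n ^ 2 = 400" using that unfolding n_def 1 by auto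
      then have "m ^ 2 < 2 ^ 2" using * nonneg by (simp; linarith)
      then have "\<bar>m\<bar> < 2" by (rule sq) simp
      then show ?thesis using that unfolding m_def 1 by presburger
    qed
    moreover have "a = 0 \<or> a = 1 \<or> a = -1" if "b = 0"
      using m that unfolding m_def 1 by presburger
    ultimately show ?thesis using 1 by auto
  next
    case 2
    have "n ^ 2 < 11 ^ 2" using * nonneg 2 by (simp; linarith)
    then have "\<bar>n\<bar> < 11" by (rule sq) simp
    then have b: "b = -1" unfolding n_def using 2 by linarith
    then have "n ^ 2 = 9" unfolding n_def 2 by simp
    then have "m ^ 2 < 2 ^ 2" using * nonneg 2 by (simp; linarith)
    then have "\<bar>m\<bar> < 2" by (rule sq) simp
    then have "a = -1" unfolding m_def b 2 by presburger
    then show ?thesis using b 2 by simp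
  next
    case 3
    have "n ^ 2 < 11 ^ 2" using * nonneg 3 by (simp; linarith)
    then have "\<bar>n\<bar> < 11" by (rule sq) simp
    then have b: "b = 1" unfolding n_def using 3 by linarith
    then have "n ^ 2 = 9" unfolding n_def 3 by simp
    then have "m ^ 2 < 2 ^ 2" using * nonneg 3 by (simp; linarith)
    then have "\<bar>m\<bar> < 2" by (rule sq) simp
    then have "a = 1" unfolding m_def b 3 by presburger
    then show ?thesis using b 3 by simp
  qed
qed

text \<open>For a unit with r = |emb u| the complex part is 1/r, so the sum of squares is r^2 + 2/r.
  On [1, 46/25] this is at most 9/2, which leaves finitely many coordinates.\<close>

lemma unit_in_fundamental_range:
  assumes "\<bar>nrm u\<bar> = 1" "1 \<le> \<bar>emb u\<bar>" "\<bar>emb u\<bar> \<le> trc"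
  shows "u \<in> {1, -1, tau, -tau, itau, -itau}"
proof -
  obtain a b c where u: "u = Trib a b c" by (cases u)
  define r where "r = \<bar>emb u\<bar>"
  have r: "1 \<le> r" "r \<le> 46 / 25" using assms trc(2) unfolding r_def by linarith+
  have "rE a b c * rQ a b c = of_int (nrm u)"
    unfolding rE_mult_rQ u by (simp add: rN_def)
  then have "\<bar>rE a b c * rQ a b c\<bar> = 1"
    using assms(1) by (metis of_int_1 of_int_abs)
  then have rq: "r * rQ a b c = 1"
    unfolding abs_mult r_def u using rQ_nonneg[of a b c] by simp
  have "r * (r ^ 2 + 2 * rQ a b c) = r ^ 3 + 2"
    using rq by (simp add: algebra_simps power2_eq_square power3_eq_cube)
  moreover have "r ^ 3 + 2 \<le> 9 / 2 * r"
  proof -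
    \<comment> \<open>r^3 lies below its chord over [1, 46/25]; the third root -71/25 of the
      difference makes the r^2 term cancel.\<close>
    have "(r - 1) * (46 / 25 - r) \<ge> 0" using r by simp
    then have "(r - 1) * (46 / 25 - r) * (r + 71 / 25) \<ge> 0" using r by simp
    moreover have "(r - 1) * (46 / 25 - r) * (r + 71 / 25) = 3891 / 625 * r - 3266 / 625 - r ^ 3"
      by Groebner_Basis.algebra
    ultimately show ?thesis using r by linarith
  qed
  ultimately have "r * (r ^ 2 + 2 * rQ a b c) \<le> r * (9 / 2)" by simp
  then have "r ^ 2 + 2 * rQ a b c \<le> 9 / 2" using r by simp
  then have "rS a b c \<le> 9 / 2" unfolding rS_def r_def u by simp
  then have le: "3 * (real_of_int a + b / 3 + c) ^ 2 + 407 / 100 * (b + 23 / 20 * c) ^ 2 + 347 / 100 * (real_of_int c) ^ 2 \<le> 9 / 2"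
    using rS_lower[of a b c] by linarith
  have 1: "(real_of_int a + b / 3 + c) ^ 2 = real_of_int ((3 * a + b + 3 * c) ^ 2) / 9"
  proof -
    have "real_of_int (3 * a + b + 3 * c) = 3 * (a + b / 3 + c)" by simp
    then show ?thesis by (simp only: of_int_power power_mult_distrib) simp
  qed
  have 2: "(b + 23 / 20 * c) ^ 2 = real_of_int ((20 * b + 23 * c) ^ 2) / 400"
  proof -
    have "real_of_int (20 * b + 23 * c) = 20 * (b + 23 / 20 * c)" by simp
    then show ?thesis by (simp only: of_int_power power_mult_distrib) simp
  qed
  have "real_of_int ((20 * b + 23 * c) ^ 2) \<ge> 0" by simp
  with le have "real_of_int (400 * (3 * a + b + 3 * c) ^ 2 + 12 * (20 * b + 23 * c) ^ 2 + 4164 * c ^ 2) \<le> 5400"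
    unfolding 1 2 of_int_add of_int_mult of_int_power[of c 2] of_int_numeral by linarith
  then have "400 * (3 * a + b + 3 * c) ^ 2 + 12 * (20 * b + 23 * c) ^ 2 + 4164 * c ^ 2 \<le> 5400"
    by linarith
  from small_coefficients[OF this] show ?thesis
    using assms(1) unfolding u by (auto simp: one_trib_def tau_def itau_def)
qed

text \<open>The four forms are the classes of the unit group modulo squares, generated by -1 and
  \<tau>.\<close>

definition square_class :: "trib \<Rightarrow> bool" where
  "square_class x \<longleftrightarrow> (\<exists>s. x = s ^ 2 \<or> x = - (s ^ 2) \<or> x = tau * s ^ 2 \<or> x = - (tau * s ^ 2))"

lemma square_class_mult:
  assumes "square_class x" "square_class y" shows "square_class (x * y)"
proof -
  have prod: "s ^ 2 * t ^ 2 = (s * t) ^ 2" "tau * s ^ 2 * (tau * t ^ 2) = (tau * s * t) ^ 2"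
    "s ^ 2 * (tau * t ^ 2) = tau * (s * t) ^ 2" "tau * s ^ 2 * t ^ 2 = tau * (s * t) ^ 2"
    for s t :: trib
    by (simp_all add: power2_eq_square algebra_simps)
  from assms obtain s t where
    "x = s ^ 2 \<or> x = - (s ^ 2) \<or> x = tau * s ^ 2 \<or> x = - (tau * s ^ 2)"
    "y = t ^ 2 \<or> y = - (t ^ 2) \<or> y = tau * t ^ 2 \<or> y = - (tau * t ^ 2)"
    unfolding square_class_def by blast
  then show ?thesis
    unfolding square_class_def
    by (elim disjE; simp only: mult_minus_left mult_minus_right minus_minus prod; blast)
qed

lemma square_class_square: "square_class (s ^ 2)"
  unfolding square_class_def by blast

lemma square_class_units:
  assumes "u \<in> {1, -1, tau, -tau, itau, -itau}" shows "square_class u"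
proof -
  have "itau = tau * itau ^ 2"
    using tau_itau by (simp add: power2_eq_square mult.assoc[symmetric])
  then show ?thesis
    using assms unfolding square_class_def
    by (metis (no_types, lifting) insert_iff mult.right_neutral power_one empty_iff)
qed

lemma square_class_power: "square_class x \<Longrightarrow> square_class (x ^ n)"
  by (induction n) (auto intro: square_class_mult square_class_units)

text \<open>The unit theorem in rank one: a suitable power of \<tau> brings the real absolute value
  into [1, trc], where the units have been listed.\<close>

lemma square_class_unit:
  assumes "\<bar>nrm u\<bar> = 1" shows "square_class u"
proof -
  define r where "r = \<bar>emb u\<bar>"
  have t: "trc > 1" using trc(1) by simp
  have "nrm u \<noteq> 0" using assms by linarith
  then have r: "r > 0" unfolding r_def using emb_nonzero by simp
  define k where "k = \<lfloor>log trc r\<rfloor>"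
  have k: "trc powr k \<le> r" "r \<le> trc powr (k + 1)"
    using t r floor_correct[of "log trc r"] powr_mono[of k "log trc r" trc] 
      powr_mono[of "log trc r" "k + 1" trc] unfolding k_def by simp_all
  have "\<exists>v w. v * w = 1 \<and> square_class w \<and> \<bar>nrm v\<bar> = 1 \<and> \<bar>emb v\<bar> = trc powr (- k)"
  proof (cases "k \<ge> 0")
    case True
    have "nrm itau = 1" by (simp add: itau_def)
    then have "nrm (itau ^ n) = 1" for n by (induction n) (simp_all add: nrm_mult)
    moreover have "itau ^ nat k * tau ^ nat k = 1"
      by (simp add: power_mult_distrib[symmetric] tau_itau)
    moreover have "\<bar>emb (itau ^ nat k)\<bar> = trc powr (- k)"
      using True t by (simp add: emb_power emb_itau powr_minus powr_realpow[symmetric] power_inverse)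
    ultimately show ?thesis
      by (metis abs_1 insertI1 insertI2 square_class_power square_class_units)
  next
    case False
    have "nrm (tau ^ n) = 1" for n by (induction n) (simp_all add: nrm_mult nrm_tau)
    moreover have "tau ^ nat (- k) * itau ^ nat (- k) = 1"
      by (simp add: power_mult_distrib[symmetric] tau_itau)
    moreover have "\<bar>emb (tau ^ nat (- k))\<bar> = trc powr (- k)"
      using False t by (simp add: emb_power emb_tau powr_realpow[symmetric])
    ultimately show ?thesis
      by (metis abs_1 insertI1 insertI2 square_class_power square_class_units)
  qed
  then obtain v w where vw: "v * w = 1" "square_class w" "\<bar>nrm v\<bar> = 1" "\<bar>emb v\<bar> = trc powr (- k)"
    by blast
  have "u * v \<in> {1, -1, tau, -tau, itau, -itau}"
  proof (rule unit_in_fundamental_range)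
    show "\<bar>nrm (u * v)\<bar> = 1" using assms vw by (simp add: nrm_mult abs_mult)
    have e: "\<bar>emb (u * v)\<bar> = r * trc powr (- k)"
      by (simp add: emb_mult abs_mult vw r_def)
    have "trc powr k * trc powr (- k) \<le> r * trc powr (- k)" 
      "r * trc powr (- k) \<le> trc powr (k + 1) * trc powr (- k)"
      using k by (intro mult_right_mono; simp)+
    then show "1 \<le> \<bar>emb (u * v)\<bar>" "\<bar>emb (u * v)\<bar> \<le> trc"
      unfolding e using t by (simp_all add: powr_add[symmetric])
  qed
  then have "square_class (u * v * w)"
    using square_class_units square_class_mult vw(2) by blast
  then show ?thesis by (simp add: mult.assoc vw(1))
qed

text \<open>The two elements \<open>D\<close> used in the descents have norms 176 = 16 * 11 and
  44.\<close>

lemma square_dvd_176: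
  fixes t :: int
  assumes "t ^ 2 dvd 176" shows "t ^ 2 \<in> {1, 4, 16}"
proof -
  have "t ^ 2 \<le> 176" using assms by (rule zdvd_imp_le) simp
  then have "\<bar>t\<bar> ^ 2 < 14 ^ 2" by simp
  then have "\<bar>t\<bar> < 14" by (rule power_less_imp_less_base) simp
  then have "nat \<bar>t\<bar> < 14" by simp
  moreover have "nat \<bar>t\<bar> ^ 2 dvd 176"
    using assms by (simp add: nat_dvd_iff flip: int_dvd_int_iff)
  moreover have "n \<in> {1, 2, 4}" if "n < 14" "n ^ 2 dvd 176" for n :: nat
  proof -
    have "n \<in> {0, 1, 2, 3, 4, 5, 6, 7, 8, 9, 10, 11, 12, 13}"
      using that(1) by (simp add: less_Suc_eq numeral_eq_Suc)
    with that(2) show ?thesis by auto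
  qed
  ultimately have "nat \<bar>t\<bar> \<in> {1, 2, 4}" by blast
  then have "\<bar>t\<bar> \<in> {1, 2, 4}" by auto
  then have "t = 1 \<or> t = -1 \<or> t = 2 \<or> t = -2 \<or> t = 4 \<or> t = -4" by auto
  then show ?thesis by auto
qed

lemma square_class_nrm_4:
  assumes "nrm x = 4 * m"
  obtains y where "x = pi2 ^ 2 * y" "nrm y = m"
proof -
  have "even (nrm x)" using assms by simp
  then obtain z where z: "x = pi2 * z" "nrm x = 2 * nrm z" by (rule pi2_dvd)
  have "even (nrm z)" using assms z(2) by simp
  then obtain y where y: "z = pi2 * y" "nrm z = 2 * nrm y" by (rule pi2_dvd)
  show ?thesis
  proof (rule that)
    show "x = pi2 ^ 2 * y" using z(1) y(1) by (simp add: power2_eq_square mult.assoc)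
    show "nrm y = m" using assms z(2) y(2) by simp
  qed
qed

text \<open>The non-square part \<open>K\<close> of x is a common divisor of x and y, hence of
  \<open>D\<close>. Its norm is a square dividing 176, so it is 1, 4 or 16, and \<open>K\<close> is
  a unit times an even power of \<open>pi2\<close>.\<close>

lemma trib_square:
  fixes k :: int
  assumes xy: "x * y = z ^ 2" and D: "D = s * x + t * y" "nrm D dvd 176"
    and x: "nrm x = k ^ 2" "x \<noteq> 0"
  obtains w where "x = w ^ 2 \<or> x = tau * w ^ 2"
proof -
  \<comment> \<open>\<open>g\<^sup>2\<close> generates \<open>(x\<^sup>2, x z, z\<^sup>2) = x (x, y, z)\<close>, so \<open>K = g\<^sup>2 / x\<close> generates \<open>(x, y, z)\<close>.\<close>
  obtain g p q where g: "g dvd x" "g dvd z" "g = p * x + q * z" by (rule trib_bezout)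
  then obtain x' z' where x': "x = g * x'" and z': "z = g * z'" by (elim dvdE)
  define K where "K = p ^ 2 * x + 2 * p * q * z + q ^ 2 * y"
  have "g ^ 2 = p ^ 2 * x ^ 2 + 2 * p * q * x * z + q ^ 2 * z ^ 2"
    unfolding g(3) by (simp add: power2_eq_square algebra_simps)
  also have "\<dots> = x * K"
    unfolding xy[symmetric] K_def by (simp add: power2_eq_square algebra_simps)
  also have "\<dots> = g * (x' * K)" unfolding x' by (simp add: mult.assoc)
  finally have gK: "g = x' * K" using x(2) x' by (auto simp: power2_eq_square)
  have xK: "x = K * x' ^ 2" unfolding x' gK by (simp add: power2_eq_square mult_ac)
  have "K * x' ^ 2 * y = K * x' ^ 2 * (K * z' ^ 2)"
    using xy unfolding xK z' gK by (simp add: power_mult_distrib power2_eq_square mult_ac)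
  then have yK: "y = K * z' ^ 2" using x(2) xK by auto
  have "K dvd D" unfolding D(1) by (intro dvd_add dvd_mult) (simp_all add: xK yK)
  then obtain L where "D = K * L" by (elim dvdE)
  then have dvd: "nrm K dvd 176" using D(2) by (simp add: nrm_mult dvd_mult_left)
  have k: "nrm K * nrm x' ^ 2 = k ^ 2"
    unfolding x(1)[symmetric] xK by (simp add: nrm_mult power2_eq_square)
  have x'0: "nrm x' \<noteq> 0" using x(2) xK by auto
  have "nrm x' ^ 2 dvd k ^ 2" unfolding k[symmetric] by simp
  then have "nrm x' dvd k" by simp
  then obtain n where n: "k = nrm x' * n" by (elim dvdE)
  have nK: "nrm K = n ^ 2" using k x'0 unfolding n by (simp add: power2_eq_square)
  then have "n ^ 2 \<in> {1, 4, 16}" using dvd square_dvd_176 by simp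
  then consider "nrm K = 1" | "nrm K = 4 * 1" | "nrm K = 4 * (4 * 1)" using nK by auto
  then have "square_class K"
  proof cases
    case 1
    then show ?thesis by (intro square_class_unit) simp
  next
    case 2
    then obtain y where "K = pi2 ^ 2 * y" "nrm y = 1" by (rule square_class_nrm_4)
    then show ?thesis by (simp add: square_class_mult square_class_square square_class_unit)
  next
    case 3
    then obtain y where y: "K = pi2 ^ 2 * y" "nrm y = 4 * 1" by (rule square_class_nrm_4)
    from y(2) obtain z where z: "y = pi2 ^ 2 * z" "nrm z = 1" by (rule square_class_nrm_4)
    then have "square_class z" by (intro square_class_unit) simp
    then show ?thesis
      unfolding y(1) z(1) by (intro square_class_mult square_class_square)
  qed
  then have "square_class x"
    unfolding xK by (intro square_class_mult square_class_square)
  then obtain w where w: "x = w ^ 2 \<or> x = - (w ^ 2) \<or> x = tau * w ^ 2 \<or> x = - (tau * w ^ 2)"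
    unfolding square_class_def by blast
  \<comment> \<open>Since -1 has norm -1 and \<tau> has norm 1, positivity rules out the two
    negative classes.\<close>
  have "nrm x > 0" using x nrm_eq_0_iff[of x] by (metis less_eq_real_def zero_le_power2 order_le_less)
  moreover have "nrm (- (w ^ 2)) \<le> 0" "nrm (- (tau * w ^ 2)) \<le> 0"
    by (simp_all add: nrm_uminus nrm_mult nrm_tau power2_eq_square)
  ultimately show ?thesis using w that by fastforce
qed

section \<open>Rational points by descent\<close>

lemma trib_power2:
  "Trib p q r ^ 2 = Trib (p^2 + 2*q*r + r^2) (2 * (p*q + q*r + r^2)) (q^2 + 2*p*r + 2*q*r + 2*r^2)"
  by (simp add: power2_eq_square algebra_simps)

lemma tau_mult: "tau * Trib a b c = Trib c (a + c) (b + c)"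
  by (simp add: tau_def)

text \<open>In the applications \<open>D\<close> is the derivative of the minimal polynomial of \<open>\<kappa>\<close>, evaluated at \<open>\<kappa>\<close>:
  a common divisor of \<open>x = a + b \<kappa>\<close> and \<open>adj x\<close> divides both \<open>a\<^sup>2 D\<close> and \<open>b\<^sup>2 D\<close>.\<close>

lemma linear_form_square:
  fixes a b k :: int
  assumes x: "x = of_int a + of_int b * \<kappa>"
    and cop: "coprime a b" and adj: "adj (x) = of_int (b ^ 2) * D + m * x"
    and D: "nrm D dvd 176" and k: "nrm (x) = k ^ 2" and nz: "x \<noteq> 0"
  obtains p q r where "x = Trib p q r ^ 2 \<or> x = tau * Trib p q r ^ 2"
proof -
  have "coprime (a ^ 2) (b ^ 2)" using cop by simp
  then obtain i j where ij: "i * a ^ 2 + j * b ^ 2 = 1"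
    by (metis bezout_int coprime_iff_gcd_eq_1)
  have b: "of_int (b ^ 2) * D = adj (x) - m * x"
    using adj by simp
  have "of_int (a ^ 2) = x * (of_int a - of_int b * \<kappa>) + of_int (b ^ 2) * \<kappa> ^ 2"
    unfolding x by (simp add: power2_eq_square algebra_simps)
  then have "of_int (a ^ 2) * D = (x * (of_int a - of_int b * \<kappa>) + of_int (b ^ 2) * \<kappa> ^ 2) * D"
    by (simp only:)
  also have "\<dots> = D * (of_int a - of_int b * \<kappa>) * x + \<kappa> ^ 2 * (of_int (b ^ 2) * D)"
    by (simp add: algebra_simps)
  also have "\<dots> = (D * (of_int a - of_int b * \<kappa>) - \<kappa> ^ 2 * m) * x + \<kappa> ^ 2 * adj (x)"
    unfolding b by (simp add: algebra_simps)
  finally have a: "of_int (a ^ 2) * D = \<dots>" .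
  have "D = of_int (i * a ^ 2 + j * b ^ 2) * D" unfolding ij by simp
  also have "\<dots> = of_int i * (of_int (a ^ 2) * D) + of_int j * (of_int (b ^ 2) * D)"
    by (simp add: algebra_simps)
  also have "\<dots> = (of_int i * (D * (of_int a - of_int b * \<kappa>) - \<kappa> ^ 2 * m) - of_int j * m) * x
      + (of_int i * \<kappa> ^ 2 + of_int j) * adj (x)"
    unfolding a b by (simp add: algebra_simps)
  finally have D_comb: "D = \<dots>" .
  have "x * adj (x) = of_int k ^ 2"
    unfolding mult_adj k by simp
  then obtain w where "x = w ^ 2 \<or> x = tau * w ^ 2"
    using trib_square[OF _ D_comb D k nz] by blast
  then show ?thesis using that by (metis trib.exhaust)
qed

section \<open>Integer points and their descents\<close>

lemma coprime_by_primes: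
  fixes a b :: int
  assumes "\<And>p. Factorial_Ring.prime p \<Longrightarrow> p dvd a \<Longrightarrow> p dvd b \<Longrightarrow> False"
  shows "coprime a b"
proof (rule ccontr)
  assume "\<not> coprime a b"
  then have "\<not> is_unit (gcd a b)" by (simp add: coprime_iff_gcd_eq_1)
  show False
  proof (cases "gcd a b = 0")
    case True
    then show ?thesis using assms[of 2] by simp
  next
    case False
    with \<open>\<not> is_unit (gcd a b)\<close> obtain p where "Factorial_Ring.prime p" "p dvd gcd a b"
      using prime_divisor_exists by blast
    then show ?thesis using assms by auto
  qed
qed

text \<open>A zero factor is allowed, since the other one is then a unit. Both factors share the
  sign \<open>s\<close> because their product is a square; the sign of \<open>w\<close> is absorbed
  into \<open>m\<close>.\<close>

lemma coprime_product_square: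
  fixes u v w :: int
  assumes "coprime u v" "u * v = w ^ 2"
  obtains s m n where "s = 1 \<or> s = -1" "u = s * m ^ 2" "v = s * n ^ 2" "w = m * n"
proof (cases "u = 0 \<or> v = 0")
  case True
  then have w: "w = 0" using assms(2) by (metis mult_eq_0_iff zero_eq_power2)
  show ?thesis
  proof (cases "u = 0")
    case True
    then have "is_unit v" using assms(1) by simp
    then have "v = 1 \<or> v = -1" by (auto simp: abs_if split: if_splits)
    then show ?thesis using that[of v 0 1] True w by auto
  next
    case False
    then have "v = 0" using True by simp
    then have "is_unit u" using assms(1) by simp
    then have "u = 1 \<or> u = -1" by (auto simp: abs_if split: if_splits)
    then show ?thesis using that[of u 1 0] \<open>v = 0\<close> w by auto
  qed
next
  case False
  have "nat \<bar>u\<bar> * nat \<bar>v\<bar> = nat \<bar>w\<bar> ^ 2"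
    using assms(2) by (metis abs_mult nat_abs_mult_distrib nat_power_eq abs_ge_zero power_abs)
  moreover have "coprime (nat \<bar>u\<bar>) (nat \<bar>v\<bar>)" using assms(1) by simp
  ultimately have "is_nth_power 2 (nat \<bar>u\<bar>)" "is_nth_power 2 (nat \<bar>v\<bar>)"
    using is_nth_power_mult_coprime_natD[of "nat \<bar>u\<bar>" "nat \<bar>v\<bar>" 2] False by auto
  then obtain m n where "nat \<bar>u\<bar> = m ^ 2" "nat \<bar>v\<bar> = n ^ 2"
    by (auto elim!: is_nth_powerE)
  then have mn: "\<bar>u\<bar> = int m ^ 2" "\<bar>v\<bar> = int n ^ 2"
    by (metis abs_ge_zero int_nat_eq of_nat_power)+
  define s where "s = sgn u"
  have s: "s = 1 \<or> s = -1" using False unfolding s_def by (simp add: sgn_if)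
  have "u * v \<noteq> 0" using False by simp
  moreover have "u * v \<ge> 0" unfolding assms(2) by simp
  ultimately have "u * v > 0" by linarith
  then have "sgn v = s" unfolding s_def by (auto simp: sgn_if zero_less_mult_iff)
  then have uv: "u = s * int m ^ 2" "v = s * int n ^ 2"
    unfolding mn[symmetric] s_def by (metis sgn_mult_abs)+
  have "w ^ 2 = (int m * int n) ^ 2"
    using s unfolding assms(2)[symmetric] uv by (auto simp: power_mult_distrib)
  then have "w = int m * int n \<or> w = - int m * int n" by (simp add: power2_eq_iff)
  then show ?thesis
    using that[of s "int m" "int n"] that[of s "- int m" "int n"] s uv by auto
qed

text \<open>Points of \<open>Y\<^sup>2 = 4 X\<^sup>3 - 4 X\<^sup>2 + 1\<close> with \<open>X = A / l\<^sup>2\<close> are divisible by \<open>2\<close>;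
  \<open>u\<close> and \<open>v\<close> parametrise the halves.\<close>

lemma first_descent:
  fixes A l k :: int
  assumes cop: "coprime A l" and eq: "4 * A ^ 3 - 4 * A ^ 2 * l ^ 2 + l ^ 6 = k ^ 2"
  obtains u v where "coprime u v" "A = u ^ 4 + 2 * u ^ 3 * v - 2 * u * v ^ 3"
    "l ^ 2 = v ^ 4 + 2 * u ^ 2 * v ^ 2 + 4 * u ^ 3 * v + u ^ 4"
proof -
  \<comment> \<open>\<kappa> = \<tau>^2 - 1 = 2 / (\<tau> - 1), chosen so that l^2 + A \<kappa> has
    the left-hand side of \<open>eq\<close> as its norm.\<close>
  define \<kappa> where "\<kappa> = Trib (-1) 0 1"
  have x: "of_int (l ^ 2) + of_int A * \<kappa> = Trib (l ^ 2 - A) 0 A"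
    unfolding trib_of_int \<kappa>_def by simp
  have "x = Trib (l ^ 2 - A) 0 A \<Longrightarrow> x \<noteq> 0" for x
    using cop by (auto simp: zero_trib_def)
  moreover have "coprime (l ^ 2) A" using cop by (simp add: coprime_commute)
  moreover have "adj (Trib (l ^ 2 - A) 0 A) =
      of_int (A ^ 2) * Trib 2 6 0 + Trib (l ^ 2 + 2 * A) 0 (- 2 * A) * Trib (l ^ 2 - A) 0 A"
    unfolding trib_of_int by (simp add: power2_eq_square algebra_simps)
  moreover have "nrm (Trib 2 6 0) dvd 176" by simp
  moreover have "nrm (Trib (l ^ 2 - A) 0 A) = k ^ 2"
    unfolding eq[symmetric] by (simp add: algebra_simps eval_nat_numeral)
  ultimately obtain p q r where "Trib (l ^ 2 - A) 0 A = Trib p q r ^ 2 \<or>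
      Trib (l ^ 2 - A) 0 A = tau * Trib p q r ^ 2"
    using linear_form_square[OF x[symmetric], of "Trib 2 6 0" "Trib (l ^ 2 + 2 * A) 0 (- 2 * A)" k]
    by blast
  then show ?thesis
  proof
    \<comment> \<open>The class of \<tau> fails by parity: \<open>l\<close> is even and
      \<open>A\<close> odd, the vanishing \<tau>-coordinate \<open>AC\<close> makes q, p + r and r
      odd, and then \<open>B\<close> makes \<open>A\<close> even.\<close>
    assume "Trib (l ^ 2 - A) 0 A = tau * Trib p q r ^ 2"
    then have C: "l ^ 2 - A = q^2 + 2*p*r + 2*q*r + 2*r^2"
      and AC: "(p + r) ^ 2 + q ^ 2 + 2 * r ^ 2 + 4 * q * r = 0"
      and B: "2 * A = l ^ 2 + 2 * (q * (p + r) + r ^ 2)"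
      unfolding trib_power2 tau_mult by (simp_all add: power2_eq_square algebra_simps)
    have "l ^ 2 = 2 * (A - (q * (p + r) + r ^ 2))" unfolding right_diff_distrib B by simp
    then have "even (l ^ 2)" by (metis dvd_triv_left)
    then have l: "even l" by simp
    then have A: "odd A" using cop by (metis coprime_common_divisor odd_one)
    with C l have q: "odd q" by (metis even_add even_diff even_mult_iff even_numeral even_power pos2)
    have "even ((p + r) ^ 2 + q ^ 2 + 2 * r ^ 2 + 4 * q * r)" unfolding AC by simp
    with q have pr: "odd (p + r)" by simp
    obtain i j where "q = 2 * i + 1" "p + r = 2 * j + 1" using q pr by (elim oddE)
    then have "2 * (1 + r ^ 2 + 2 * (j ^ 2 + j + i ^ 2 + i + q * r)) = 0"
      using AC by (simp add: power2_eq_square algebra_simps)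
    then have "1 + r ^ 2 + 2 * (j ^ 2 + j + i ^ 2 + i + q * r) = 0"
      by (metis mult_eq_0_iff zero_neq_numeral)
    then have "even (1 + r ^ 2 + 2 * (j ^ 2 + j + i ^ 2 + i + q * r))" by (simp only: dvd_0_right)
    then have "even (1 + r ^ 2)" by (simp only: even_add even_mult_iff) simp
    then have "even (q * (p + r) + r ^ 2)" using q pr by simp
    then obtain c where "q * (p + r) + r ^ 2 = 2 * c" by (elim evenE)
    moreover obtain l' where "l = 2 * l'" using l by (elim evenE)
    ultimately have "2 * A = 2 * (2 * (l' ^ 2 + c))" using B by (simp add: power2_eq_square)
    then have "A = 2 * (l' ^ 2 + c)" by (metis mult_left_cancel zero_neq_numeral)
    then have "even A" by (metis dvd_triv_left)
    with A show ?thesis by simp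
  next
    assume "Trib (l ^ 2 - A) 0 A = Trib p q r ^ 2"
    \<comment> \<open>Here the vanishing \<tau>-coordinate is the conic \<open>B\<close>; its two
      factors turn out coprime, which yields the parameters.\<close>
    then have lA: "l ^ 2 - A = p^2 + 2*q*r + r^2" and B: "q * - (p + r) = r ^ 2"
      and A: "A = q^2 + 2*p*r + 2*q*r + 2*r^2"
      unfolding trib_power2 by (simp_all add: algebra_simps)
    have no_prime: False if "Factorial_Ring.prime P" "P dvd p" "P dvd q" "P dvd r" for P
    proof -
      have "P dvd A" unfolding A using that by (simp add: power2_eq_square)
      moreover have "P dvd l ^ 2 - A" unfolding lA using that by (simp add: power2_eq_square)
      ultimately have "P dvd l ^ 2" by (metis dvd_diffD diff_add_cancel dvd_add)
      then have "P dvd l" using that(1) prime_dvd_power by blast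
      with \<open>P dvd A\<close> show False using cop that(1) by (meson coprime_common_divisor not_prime_unit)
    qed
    have "coprime q (- (p + r))"
    proof (rule coprime_by_primes)
      fix P :: int assume P: "Factorial_Ring.prime P" "P dvd q" "P dvd - (p + r)"
      then have "P dvd r ^ 2" unfolding B[symmetric] by simp
      then have "P dvd r" using P(1) prime_dvd_power by blast
      moreover have "P dvd p" using P(3) \<open>P dvd r\<close> by (simp only: dvd_minus_iff dvd_add_left_iff)
      ultimately show False using no_prime P by blast
    qed
    from coprime_product_square[OF this B] obtain s u v where
      s: "s = 1 \<or> s = -1" and q: "q = s * u ^ 2" and pr: "- (p + r) = s * v ^ 2" and r: "r = u * v" .
    have p: "p = - s * v ^ 2 - u * v" using pr r by simp
    have cop: "coprime (s * u) v"
    proof (rule coprime_by_primes)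
      fix P :: int assume P: "Factorial_Ring.prime P" "P dvd s * u" "P dvd v"
      then have "P dvd u" using s by auto
      then show False using no_prime[of P] P unfolding p q r by (simp add: power2_eq_square)
    qed
    show ?thesis
    proof (rule that[OF cop])
      show "A = (s * u) ^ 4 + 2 * (s * u) ^ 3 * v - 2 * (s * u) * v ^ 3"
        using s unfolding A p q r by (auto simp: eval_nat_numeral algebra_simps)
      have l2: "l ^ 2 = (p^2 + 2*q*r + r^2) + (q^2 + 2*p*r + 2*q*r + 2*r^2)"
        using lA A by simp
      show "l ^ 2 = v ^ 4 + 2 * (s * u) ^ 2 * v ^ 2 + 4 * (s * u) ^ 3 * v + (s * u) ^ 4"
        using s unfolding l2 p q r by (auto simp: eval_nat_numeral algebra_simps)
    qed
  qed
qed

text \<open>The case \<open>u v < 0\<close> of the next lemma, with \<open>w = - v\<close> or \<open>w = - u\<close>.\<close>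

lemma first_descent_size_aux:
  fixes u w :: int
  assumes "u > 0" "w > 0" "max (u ^ 2) (w ^ 2) \<ge> 4"
    and nonneg: "w ^ 4 + 2 * u ^ 2 * w ^ 2 - 4 * u ^ 3 * w + u ^ 4 \<ge> 0"
  shows "max (u ^ 2) (w ^ 2) < max (u ^ 4 - 2 * u ^ 3 * w + 2 * u * w ^ 3)
    (w ^ 4 + 2 * u ^ 2 * w ^ 2 - 4 * u ^ 3 * w + u ^ 4)"
proof -
  have less: "x ^ 2 < y" if "x ^ 4 \<le> 3 * y" "x ^ 2 \<ge> 4" for x y :: int
  proof -
    have "4 * x ^ 2 \<le> x ^ 2 * x ^ 2" using that(2) by (intro mult_right_mono) auto
    also have "\<dots> = x ^ 4" by (simp flip: power_add)
    finally show ?thesis using that by linarith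
  qed
  \<comment> \<open>One of the two polynomials reaches a third of the larger fourth power. For w < u
    nonnegativity of the second one forces u >= 3 w, and the first is large. For w > u the second is
    large if w <= 3 (w - u), that is 3 u <= 2 w, and otherwise the first.\<close>
  consider "w = u" | "w < u" | "u < w" "3 * u \<le> 2 * w" | "u < w" "2 * w < 3 * u" by linarith
  then show ?thesis
  proof cases
    case 1
    have "u ^ 4 - 2 * u ^ 3 * w + 2 * u * w ^ 3 = u ^ 4" unfolding 1 by (simp add: eval_nat_numeral)
    moreover have "u ^ 2 < u ^ 4" using less[of u "u ^ 4"] assms(3) unfolding 1 by simp
    ultimately show ?thesis using 1 by simp
  next
    case 2
    have "w ^ 4 + 2 * u ^ 2 * w ^ 2 - 4 * u ^ 3 * w + u ^ 4 = (u - w) * (u ^ 2 * (u - 3 * w) - (u * w ^ 2 + w ^ 3))"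
      by (simp add: eval_nat_numeral algebra_simps)
    with nonneg 2 have "u ^ 2 * (u - 3 * w) - (u * w ^ 2 + w ^ 3) \<ge> 0"
      by (simp add: zero_le_mult_iff)
    moreover have "u * w ^ 2 + w ^ 3 \<ge> 0" using assms by simp
    ultimately have "u ^ 2 * (u - 3 * w) \<ge> 0" by linarith
    then have "u \<ge> 3 * w" using assms(1) by (simp add: zero_le_mult_iff)
    then have "u ^ 3 * (2 * u - 6 * w) \<ge> 0" "u * w ^ 3 \<ge> 0" using assms by simp_all
    moreover have "3 * (u ^ 4 - 2 * u ^ 3 * w + 2 * u * w ^ 3) = u ^ 4 + u ^ 3 * (2 * u - 6 * w) + 6 * (u * w ^ 3)"
      by (simp add: eval_nat_numeral algebra_simps)
    ultimately have "u ^ 4 \<le> 3 * (u ^ 4 - 2 * u ^ 3 * w + 2 * u * w ^ 3)" by linarith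
    moreover have max: "max (u ^ 2) (w ^ 2) = u ^ 2" using 2 assms by (simp add: max_def power_mono)
    ultimately have "u ^ 2 < u ^ 4 - 2 * u ^ 3 * w + 2 * u * w ^ 3"
      using less assms(3) by simp
    then show ?thesis unfolding max by simp
  next
    case 3
    have max: "max (u ^ 2) (w ^ 2) = w ^ 2" using 3 assms by (simp add: max_def)
    have "u ^ 3 \<le> u ^ 2 * w" using 3 assms by (simp add: power3_eq_cube power2_eq_square mult_left_mono)
    moreover have "0 \<le> u ^ 2 * w" "0 \<le> w ^ 2 * u" using assms by simp_all
    ultimately have "w ^ 3 \<le> w ^ 3 + w ^ 2 * u + 3 * (u ^ 2 * w) - u ^ 3" by linarith
    then have "w * w ^ 3 \<le> (3 * (w - u)) * (w ^ 3 + w ^ 2 * u + 3 * (u ^ 2 * w) - u ^ 3)"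
      using 3 assms by (intro mult_mono) simp_all
    also have "\<dots> = 3 * (w ^ 4 + 2 * u ^ 2 * w ^ 2 - 4 * u ^ 3 * w + u ^ 4)"
      by (simp add: eval_nat_numeral algebra_simps)
    finally have "w ^ 4 \<le> 3 * (w ^ 4 + 2 * u ^ 2 * w ^ 2 - 4 * u ^ 3 * w + u ^ 4)"
      by (simp add: eval_nat_numeral)
    then have "w ^ 2 < w ^ 4 + 2 * u ^ 2 * w ^ 2 - 4 * u ^ 3 * w + u ^ 4"
      using less assms(3) max by simp
    then show ?thesis unfolding max by simp
  next
    case 4
    have max: "max (u ^ 2) (w ^ 2) = w ^ 2" using 4 assms by (simp add: max_def)
    have "u ^ 2 \<le> w * u" using 4 assms by (simp add: power2_eq_square)
    then have "0 \<le> (w - u) * (w ^ 2 + w * u - u ^ 2)" using 4 assms by (intro mult_nonneg_nonneg) simp_all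
    then have "w ^ 3 \<le> w ^ 3 + (w - u) * (w ^ 2 + w * u - u ^ 2)" by simp
    then have "w * w ^ 3 \<le> (3 * u) * (w ^ 3 + (w - u) * (w ^ 2 + w * u - u ^ 2))"
      using 4 assms by (intro mult_mono) simp_all
    also have "\<dots> = 3 * (u ^ 4 - 2 * u ^ 3 * w + 2 * u * w ^ 3)"
      by (simp add: eval_nat_numeral algebra_simps)
    finally have "w ^ 4 \<le> 3 * (u ^ 4 - 2 * u ^ 3 * w + 2 * u * w ^ 3)"
      by (simp add: eval_nat_numeral)
    then have "w ^ 2 < u ^ 4 - 2 * u ^ 3 * w + 2 * u * w ^ 3"
      using less assms(3) max by simp
    then show ?thesis unfolding max by simp
  qed
qed

text \<open>If u v >= 0, no term of l^2 is negative and l^2 alone suffices. With opposite signs l^2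
  may nearly cancel, which is why \<open>A\<close> enters the maximum.\<close>

lemma first_descent_size:
  fixes u v A l :: int
  assumes "A = u ^ 4 + 2 * u ^ 3 * v - 2 * u * v ^ 3"
    "l ^ 2 = v ^ 4 + 2 * u ^ 2 * v ^ 2 + 4 * u ^ 3 * v + u ^ 4" "\<bar>u\<bar> \<ge> 2 \<or> \<bar>v\<bar> \<ge> 2"
  shows "max (u ^ 2) (v ^ 2) < max \<bar>A\<bar> (l ^ 2)"
proof -
  have sq: "4 \<le> x ^ 2" if "\<bar>x\<bar> \<ge> 2" for x :: int
    using power_mono[OF that, of 2] by simp
  then have S: "4 \<le> max (u ^ 2) (v ^ 2)" using assms(3) by (metis le_max_iff_disj)
  show ?thesis
  proof (cases "u * v \<ge> 0")
    case True
    then have "u ^ 2 * (u * v) \<ge> 0" by simp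
    then have "4 * u ^ 3 * v \<ge> 0" by (simp add: eval_nat_numeral mult.assoc)
    moreover have "u ^ 2 * v ^ 2 \<ge> 0" "u ^ 4 \<ge> 0" "v ^ 4 \<ge> 0" by simp_all
    ultimately have "u ^ 4 \<le> l ^ 2" "v ^ 4 \<le> l ^ 2" unfolding assms(2) by linarith+
    moreover have "x ^ 2 < x ^ 4" if "4 \<le> x ^ 2" for x :: int
    proof -
      have "4 * x ^ 2 \<le> x ^ 2 * x ^ 2" using that by (intro mult_right_mono) auto
      also have "\<dots> = x ^ 4" by (simp flip: power_add)
      finally show ?thesis using that by linarith
    qed
    ultimately have "max (u ^ 2) (v ^ 2) < l ^ 2"
      using S by (cases "u ^ 2 \<le> v ^ 2") (simp_all add: max_def, force+)
    then show ?thesis by (rule less_le_trans) simp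
  next
    case False
    then consider "u > 0" "v < 0" | "u < 0" "v > 0" by (auto simp: zero_le_mult_iff)
    then show ?thesis
    proof cases
      case 1
      then have "max (u ^ 2) ((- v) ^ 2) < max (u ^ 4 - 2 * u ^ 3 * (- v) + 2 * u * (- v) ^ 3)
          ((- v) ^ 4 + 2 * u ^ 2 * (- v) ^ 2 - 4 * u ^ 3 * (- v) + u ^ 4)"
        by (intro first_descent_size_aux) (use S assms(2) zero_le_power2[of l] in simp_all)
      then have "max (u ^ 2) (v ^ 2) < max A (l ^ 2)" unfolding assms(1,2) by simp
      also have "\<dots> \<le> max \<bar>A\<bar> (l ^ 2)" by (rule max.mono) simp_all
      finally show ?thesis .
    next
      case 2
      then have "max ((- u) ^ 2) (v ^ 2) < max ((- u) ^ 4 - 2 * (- u) ^ 3 * v + 2 * (- u) * v ^ 3)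
          (v ^ 4 + 2 * (- u) ^ 2 * v ^ 2 - 4 * (- u) ^ 3 * v + (- u) ^ 4)"
        by (intro first_descent_size_aux) (use S assms(2) zero_le_power2[of l] in simp_all)
      then have "max (u ^ 2) (v ^ 2) < max A (l ^ 2)" unfolding assms(1,2) by simp
      also have "\<dots> \<le> max \<bar>A\<bar> (l ^ 2)" by (rule max.mono) simp_all
      finally show ?thesis .
    qed
  qed
qed

text \<open>A prime of u divides only one of M and N and carries its whole power there, so g = gcd M
  u and the cofactor h separate the two shares.\<close>

lemma coprime_factors_of_cube:
  fixes M N u v :: int
  assumes "coprime M N" "coprime u v" "M * N = u ^ 3 * v" "u \<noteq> 0"
  obtains g h k n where "u = g * h" "M = g ^ 3 * k" "N = h ^ 3 * n" "v = k * n" "g > 0"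
proof -
  define g where "g = gcd M u"
  have g: "g > 0" using assms(4) unfolding g_def by simp
  obtain m h where m: "M = g * m" and h: "u = g * h" unfolding g_def by (meson dvdE gcd_dvd1 gcd_dvd2)
  have "coprime m h"
  proof -
    have "gcd (g * m) (g * h) = g * gcd m h" using g by (simp add: gcd_mult_left)
    then have "g = g * gcd m h" using g_def m h by metis
    then show ?thesis using g by (simp add: coprime_iff_gcd_eq_1)
  qed
  have "g * (m * N) = g * (h ^ 3 * (g ^ 2 * v))"
    using assms(3) unfolding m h by (simp add: power_mult_distrib eval_nat_numeral mult_ac)
  then have mN: "m * N = h ^ 3 * (g ^ 2 * v)" using g by simp
  then have "h ^ 3 dvd m * N" by simp
  then have "h ^ 3 dvd N" using \<open>coprime m h\<close> by (simp add: coprime_commute coprime_dvd_mult_right_iff)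
  then obtain n where n: "N = h ^ 3 * n" by (elim dvdE)
  have "h \<noteq> 0" using assms(4) h by auto
  have "h ^ 3 * (m * n) = h ^ 3 * (g ^ 2 * v)" using mN unfolding n by (simp add: mult_ac)
  then have mn: "m * n = g ^ 2 * v" using \<open>h \<noteq> 0\<close> by simp
  have "coprime g N" using assms(1) unfolding m by simp
  then have "coprime (g ^ 2) n" unfolding n by simp
  moreover have "g ^ 2 dvd m * n" unfolding mn by simp
  ultimately have "g ^ 2 dvd m" by (simp add: coprime_dvd_mult_left_iff)
  then obtain k where k: "m = g ^ 2 * k" by (elim dvdE)
  have "g ^ 2 * (k * n) = g ^ 2 * v" using mn unfolding k by (simp add: mult_ac)
  then have "v = k * n" using g by simp
  with h n g show ?thesis by (intro that[of g h k n]) (simp_all add: m k eval_nat_numeral)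
qed

text \<open>The exceptions are the point at infinity and the four points over X = 0 and X = 1. The
  parameters of the halved point produce a further point (A', h) of the same curve, smaller in max
  |A| (l^2).\<close>

lemma X_integral_points:
  fixes A l k :: int
  assumes "coprime A l" "4 * A ^ 3 - 4 * A ^ 2 * l ^ 2 + l ^ 6 = k ^ 2"
  shows "l = 0 \<or> A = 0 \<or> A = 1 \<and> l ^ 2 = 1"
  using assms
proof (induction "nat (max \<bar>A\<bar> (l ^ 2))" arbitrary: A l k rule: less_induct)
  case less
  obtain u v where uv: "coprime u v" and A: "A = u ^ 4 + 2 * u ^ 3 * v - 2 * u * v ^ 3"
    and l: "l ^ 2 = v ^ 4 + 2 * u ^ 2 * v ^ 2 + 4 * u ^ 3 * v + u ^ 4"
    using first_descent[OF less.prems] .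
  show ?case
  proof (cases "\<bar>u\<bar> \<ge> 2 \<or> \<bar>v\<bar> \<ge> 2")
    case False
    \<comment> \<open>u = v = 1 and u = v = -1 are the only small parameters that give no
      point.\<close>
    have eight: "l ^ 2 \<noteq> 8"
    proof
      assume "l ^ 2 = 8"
      then have "\<bar>l\<bar> ^ 2 < 3 ^ 2" "2 ^ 2 < \<bar>l\<bar> ^ 2" by simp_all
      then have "\<bar>l\<bar> < 3" "2 < \<bar>l\<bar>" by (meson abs_ge_zero power_less_imp_less_base zero_le_numeral)+
      then show False by linarith
    qed
    have "(u = 0 \<or> u = 1 \<or> u = -1) \<and> (v = 0 \<or> v = 1 \<or> v = -1)" using False by linarith
    then show ?thesis using A l eight by (elim conjE disjE) simp_all
  next
    case True
    have size: "max (u ^ 2) (v ^ 2) < max \<bar>A\<bar> (l ^ 2)"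
      using first_descent_size[OF A l True] .
    have u0: "u \<noteq> 0" and v0: "v \<noteq> 0" using True uv by (auto simp: abs_if split: if_splits)
    have "even (\<bar>l\<bar> ^ 2) \<longleftrightarrow> even (v ^ 4 + u ^ 4)" unfolding power2_abs l by simp
    then have "even (\<bar>l\<bar> - v ^ 2 - u ^ 2)" by (auto simp: abs_if)
    then obtain M where M: "\<bar>l\<bar> = 2 * M + (v ^ 2 + u ^ 2)" by (metis evenE diff_diff_eq diff_eq_eq)
    \<comment> \<open>Since l^2 = (u^2 + v^2)^2 + 4 u^3 v, the halves M and N of |l| - (u^2 + v^2)
      and |l| + (u^2 + v^2) have product u^3 v.\<close>
    define N where "N = M + (v ^ 2 + u ^ 2)"
    have "4 * (M * N) = \<bar>l\<bar> ^ 2 - (v ^ 2 + u ^ 2) ^ 2"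
      unfolding M N_def by (simp add: power2_eq_square algebra_simps)
    also have "\<dots> = 4 * (u ^ 3 * v)"
      unfolding power2_abs l by (simp add: eval_nat_numeral algebra_simps)
    finally have MN: "M * N = u ^ 3 * v" by simp
    have copMN: "coprime M N"
    proof (rule coprime_by_primes)
      fix P :: int assume P: "Factorial_Ring.prime P" "P dvd M" "P dvd N"
      then have s: "P dvd v ^ 2 + u ^ 2" unfolding N_def by (simp add: dvd_add_right_iff)
      have "P dvd u ^ 3 * v" unfolding MN[symmetric] using P by simp
      then have "P dvd u \<or> P dvd v" using P(1) prime_dvd_mult_iff prime_dvd_power by blast
      then have "P dvd u \<and> P dvd v"
      proof
        assume u: "P dvd u"
        then have "P dvd u ^ 2" by (simp add: power2_eq_square)
        then have "P dvd v ^ 2" using s by (simp add: dvd_add_left_iff)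
        then show ?thesis using u P(1) prime_dvd_power by blast
      next
        assume v: "P dvd v"
        then have "P dvd v ^ 2" by (simp add: power2_eq_square)
        then have "P dvd u ^ 2" using s by (simp add: dvd_add_right_iff)
        then show ?thesis using v P(1) prime_dvd_power by blast
      qed
      then show False using uv P(1) by (meson coprime_common_divisor not_prime_unit)
    qed
    have Msmall: "\<bar>M\<bar> \<le> max (u ^ 2) (v ^ 2)"
    proof -
      define S where "S = max (u ^ 2) (v ^ 2)"
      have S: "u ^ 2 \<le> S" "v ^ 2 \<le> S" "0 \<le> S" unfolding S_def by (simp_all add: le_max_iff_disj)
      \<comment> \<open>M is the factor of smaller absolute value, so M^4 is at most (M N)^2 = u^6
        v^2.\<close>
      have "M ^ 2 * M ^ 2 \<le> M ^ 2 * N ^ 2"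
      proof (intro mult_left_mono)
        have "N ^ 2 - M ^ 2 = (v ^ 2 + u ^ 2) * \<bar>l\<bar>" 
          unfolding M N_def by (simp add: power2_eq_square algebra_simps)
        moreover have "(v ^ 2 + u ^ 2) * \<bar>l\<bar> \<ge> 0" by simp
        ultimately show "M ^ 2 \<le> N ^ 2" by linarith
      qed simp
      also have "\<dots> = (u ^ 2 * u ^ 2) * (u ^ 2 * v ^ 2)"
        using MN by (simp add: eval_nat_numeral flip: power_mult_distrib)
          (metis MN power2_eq_square power3_eq_cube mult.assoc mult.commute mult.left_commute)
      also have "\<dots> \<le> (S * S) * (S * S)" using S by (intro mult_mono) auto
      finally have "(M ^ 2) ^ 2 \<le> (S ^ 2) ^ 2" by (simp add: power2_eq_square)
      then have "M ^ 2 \<le> S ^ 2" by (rule power2_le_imp_le) simp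
      then show ?thesis using S(3) unfolding S_def by (simp add: abs_le_square_iff flip: abs_le_square_iff)
    qed
    obtain g h K n where gh: "u = g * h" "M = g ^ 3 * K" "N = h ^ 3 * n" "v = K * n" "g > 0"
      using coprime_factors_of_cube[OF copMN uv MN u0] .
    \<comment> \<open>N - M = u^2 + v^2 is a quadratic equation for n. Its discriminant is the
      polynomial of the curve at (A', h), which is therefore a square.\<close>
    define A' where "A' = - (g * K)"
    have eq: "h ^ 3 * n = g ^ 3 * K + (K ^ 2 * n ^ 2 + g ^ 2 * h ^ 2)"
      using N_def unfolding gh by (simp add: power_mult_distrib)
    have "coprime A' h"
    proof -
      have "coprime g h" using copMN unfolding gh by simp
      moreover have "coprime K h" using uv unfolding gh by (simp add: coprime_commute)
      ultimately show ?thesis unfolding A'_def by simp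
    qed
    moreover have "4 * A' ^ 3 - 4 * A' ^ 2 * h ^ 2 + h ^ 6 = (h ^ 3 - 2 * K ^ 2 * n) ^ 2"
    proof -
      have "(h ^ 3 - 2 * K ^ 2 * n) ^ 2 = h ^ 6 - 4 * K ^ 2 * (h ^ 3 * n) + 4 * K ^ 4 * n ^ 2"
        by (simp add: eval_nat_numeral algebra_simps)
      also have "\<dots> = 4 * A' ^ 3 - 4 * A' ^ 2 * h ^ 2 + h ^ 6"
        unfolding eq A'_def by (simp add: eval_nat_numeral algebra_simps)
      finally show ?thesis ..
    qed
    moreover have "nat (max \<bar>A'\<bar> (h ^ 2)) < nat (max \<bar>A\<bar> (l ^ 2))"
    proof -
      have "\<bar>g * K\<bar> \<le> \<bar>M\<bar>"
      proof -
        have "1 \<le> g ^ 2" using gh(5) by simp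
        then have "\<bar>g * K\<bar> * 1 \<le> \<bar>g * K\<bar> * g ^ 2" by (intro mult_left_mono) auto
        also have "\<dots> = \<bar>M\<bar>" using gh(5) unfolding gh(2) by (simp add: abs_mult eval_nat_numeral)
        finally show ?thesis by simp
      qed
      moreover have "h ^ 2 \<le> u ^ 2"
      proof -
        have "1 * h ^ 2 \<le> g ^ 2 * h ^ 2" using gh(5) by (intro mult_right_mono) auto
        then show ?thesis unfolding gh(1) by (simp add: power_mult_distrib)
      qed
      ultimately have "\<bar>A'\<bar> \<le> max (u ^ 2) (v ^ 2) \<and> h ^ 2 \<le> max (u ^ 2) (v ^ 2)"
        using Msmall unfolding A'_def abs_minus_cancel by (meson max.coboundedI1 order_trans)
      then have "max \<bar>A'\<bar> (h ^ 2) < max \<bar>A\<bar> (l ^ 2)"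
        using size by (metis max.bounded_iff order.strict_trans1)
      moreover have "0 \<le> max \<bar>A'\<bar> (h ^ 2)" by (simp add: le_max_iff_disj)
      ultimately show ?thesis unfolding zless_nat_conj by linarith
    qed
    ultimately have "h = 0 \<or> A' = 0 \<or> A' = 1 \<and> h ^ 2 = 1"
      using less.hyps by blast
    then show ?thesis
    proof (elim disjE conjE)
      assume "h = 0" then show ?thesis using u0 gh(1) by simp
    next
      assume "A' = 0" then show ?thesis using v0 gh(4,5) unfolding A'_def by simp
    next
      \<comment> \<open>The point over X = 1 only comes from u and v of absolute value at most 1, a
        case already treated.\<close>
      assume A': "A' = 1" and h: "h ^ 2 = 1"
      have "g * (- K) = 1" using A' unfolding A'_def by simp
      then have "g = 1 \<and> - K = 1 \<or> g = -1 \<and> - K = -1" by (simp only: zmult_eq_1_iff)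
      then have g: "g = 1" and K: "K = -1" using gh(5) by auto
      have "h = 1 \<or> h = -1" using h by (simp add: power2_eq_1_iff)
      then have "h ^ 3 = h" by auto
      then have "h * n = n ^ 2" using eq h unfolding g K by simp
      then have "n * (n - h) = 0" by (simp only: power2_eq_square right_diff_distrib mult.commute)
      then have "\<bar>u\<bar> \<le> 1" "\<bar>v\<bar> \<le> 1" using \<open>h = 1 \<or> h = -1\<close> unfolding gh g K by auto
      then show ?thesis using True by linarith
    qed
  qed
qed

text \<open>Here \<open>a / e\<^sup>2\<close> and \<open>b / m\<^sup>2\<close> are abscissas of points on \<open>y\<^sup>2 = x\<^sup>3 + x\<^sup>2 + x - 1\<close>.\<close>

lemma second_descent:
  fixes a e k :: int
  assumes cop: "coprime a e" and eq: "a ^ 3 + a ^ 2 * e ^ 2 + a * e ^ 4 - e ^ 6 = k ^ 2"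
  obtains m n b where "e = 2 * (m * n) \<or> e = - 2 * (m * n)" "coprime b m"
    "b ^ 3 + b ^ 2 * m ^ 2 + b * m ^ 4 - m ^ 6 = n ^ 2"
proof -
  \<comment> \<open>\<kappa> = -1/\<tau>, because x^3 + x^2 + x - 1 is the norm of x -
    1/\<tau>.\<close>
  define \<kappa> where "\<kappa> = Trib 1 1 (-1)"
  have x: "Trib (a + e ^ 2) (e ^ 2) (- (e ^ 2)) = of_int a + of_int (e ^ 2) * \<kappa>"
    unfolding trib_of_int \<kappa>_def by simp
  have "Trib (a + e ^ 2) (e ^ 2) (- (e ^ 2)) \<noteq> 0"
    using cop by (auto simp: zero_trib_def)
  moreover have "coprime a (e ^ 2)" using cop by simp
  moreover have "adj (Trib (a + e ^ 2) (e ^ 2) (- (e ^ 2))) =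
      of_int ((e ^ 2) ^ 2) * Trib (-1) 4 (-1) +
      Trib (a - e ^ 2) (- 2 * e ^ 2) (2 * e ^ 2) * Trib (a + e ^ 2) (e ^ 2) (- (e ^ 2))"
    unfolding trib_of_int by (simp add: power2_eq_square algebra_simps)
  moreover have "nrm (Trib (-1) 4 (-1)) dvd 176" by simp
  moreover have "nrm (Trib (a + e ^ 2) (e ^ 2) (- (e ^ 2))) = k ^ 2"
    unfolding eq[symmetric] by (simp add: algebra_simps eval_nat_numeral)
  ultimately obtain p q r where "Trib (a + e ^ 2) (e ^ 2) (- (e ^ 2)) = Trib p q r ^ 2 \<or>
      Trib (a + e ^ 2) (e ^ 2) (- (e ^ 2)) = tau * Trib p q r ^ 2"
    using linear_form_square[OF x, of "Trib (-1) 4 (-1)" "Trib (a - e ^ 2) (- 2 * e ^ 2) (2 * e ^ 2)" k]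
    by blast
  then show ?thesis
  proof
    \<comment> \<open>The class of \<tau> fails modulo 4. The last two coordinates add up to 0,
      which is \<open>sum\<close>; it leads to Q and r odd and P even, and then \<open>ePQ\<close>
      gives e^2 = 3 modulo 4.\<close>
    assume "Trib (a + e ^ 2) (e ^ 2) (- (e ^ 2)) = tau * Trib p q r ^ 2"
    then have C: "a + e ^ 2 = q^2 + 2*p*r + 2*q*r + 2*r^2"
      and e: "e ^ 2 = (p + q + r)^2 + 2 * (q*r + r^2 - p*q)"
      and sum: "(p + q + 2 * r) ^ 2 + (q + 2 * r) ^ 2 = r ^ 2"
      unfolding trib_power2 tau_mult by (simp_all add: power2_eq_square algebra_simps)
    define P Q where "P = p + q + 2 * r" and "Q = q + 2 * r"
    have PQ: "P ^ 2 + Q ^ 2 = r ^ 2" using sum unfolding P_def Q_def .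
    have ePQ: "e ^ 2 = Q ^ 2 - 2 * P * Q + 2 * r * (P - Q)"
      using e sum unfolding P_def Q_def by (simp add: power2_eq_square algebra_simps)
    have "odd Q"
    proof
      assume "even Q"
      then have "even (e ^ 2)" unfolding ePQ by simp
      then have "even e" by simp
      moreover have "even q" using \<open>even Q\<close> unfolding Q_def by simp
      then have "even (a + e ^ 2)" unfolding C by simp
      ultimately show False using cop by (metis coprime_common_divisor dvd_add_left_iff even_power odd_one pos2)
    qed
    then obtain i where i: "Q = 2 * i + 1" by (elim oddE)
    have "even P"
    proof (rule ccontr)
      assume "odd P"
      then obtain j where j: "P = 2 * j + 1" by (elim oddE)
      have "even (r ^ 2)" unfolding PQ[symmetric] using \<open>odd P\<close> \<open>odd Q\<close> by simp
      then obtain c where c: "r = 2 * c" by (auto elim: evenE)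
      have "4 * (i ^ 2 + i + j ^ 2 + j) + 2 = 4 * c ^ 2"
        using PQ unfolding i j c by (simp add: power2_eq_square algebra_simps)
      then show False by presburger
    qed
    then obtain j where j: "P = 2 * j" by (elim evenE)
    have "odd (r ^ 2)" unfolding PQ[symmetric] using \<open>even P\<close> \<open>odd Q\<close> by simp
    then obtain c where c: "r = 2 * c + 1" by (auto elim: oddE)
    have "odd (e ^ 2)" unfolding ePQ using \<open>odd Q\<close> by simp
    then obtain d where d: "e = 2 * d + 1" by (auto elim: oddE)
    have "4 * (d ^ 2 + d) + 1 = 4 * (i ^ 2 + i - j * Q + r * j - 2 * c * i - c - i) - 1"
      using ePQ unfolding d i j c by (simp add: power2_eq_square algebra_simps)
    then show ?thesis by presburger
  next
    assume "Trib (a + e ^ 2) (e ^ 2) (- (e ^ 2)) = Trib p q r ^ 2"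
    then have A: "a + e ^ 2 = p^2 + 2*q*r + r^2" and B: "e ^ 2 = 2 * (p*q + q*r + r^2)"
      and C: "- (e ^ 2) = q^2 + 2*p*r + 2*q*r + 2*r^2"
      unfolding trib_power2 by simp_all
    have "even (e ^ 2)" unfolding B by simp
    then obtain e' where e': "e = 2 * e'" by (auto elim: evenE)
    have "even (- (e ^ 2))" using \<open>even (e ^ 2)\<close> by simp
    then have "even (q ^ 2)" unfolding C by simp
    then obtain q' where q': "q = 2 * q'" by (auto elim: evenE)
    have e'2: "2 * e' ^ 2 = 2 * p * q' + 2 * q' * r + r ^ 2"
      using B unfolding e' q' by (simp add: power2_eq_square algebra_simps)
    have "even (2 * p * q' + 2 * q' * r + r ^ 2)" unfolding e'2[symmetric] by simp
    then have "even (r ^ 2)" by simp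
    then obtain r' where r': "r = 2 * r'" by (auto elim: evenE)
    have B': "e' ^ 2 = p * q' + 2 * q' * r' + 2 * r' ^ 2"
      using e'2 unfolding r' by (simp add: power2_eq_square algebra_simps)
    \<comment> \<open>Again the last two coordinates e^2 and -e^2 cancel; their sum, divided by 4,
      is this conic.\<close>
    have conic: "p * - (q' + r') = (q' + 2 * r') ^ 2"
      using B C unfolding q' r' by (simp add: power2_eq_square algebra_simps)
    have no_prime: False if "Factorial_Ring.prime P" "P dvd p" "P dvd q'" "P dvd r'" for P
    proof -
      have "P dvd e' ^ 2" unfolding B' using that by (simp add: power2_eq_square)
      then have "P dvd e" unfolding e' using that(1) by (simp add: prime_dvd_power_iff)
      have "P dvd a + e ^ 2" unfolding A q' r' using that by (simp add: power2_eq_square)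
      then have "P dvd a" using \<open>P dvd e\<close> by (simp add: dvd_add_left_iff power2_eq_square)
      with \<open>P dvd e\<close> show False using cop that(1) by (meson coprime_common_divisor not_prime_unit)
    qed
    have "coprime p (- (q' + r'))"
    proof (rule coprime_by_primes)
      fix P :: int assume P: "Factorial_Ring.prime P" "P dvd p" "P dvd - (q' + r')"
      then have "P dvd (q' + 2 * r') ^ 2" unfolding conic[symmetric] by simp
      then have "P dvd q' + 2 * r'" using P(1) prime_dvd_power by blast
      moreover have qr: "P dvd q' + r'" using P(3) by (simp only: dvd_minus_iff)
      ultimately have "P dvd (q' + 2 * r') - (q' + r')" by (rule dvd_diff)
      then have "P dvd r'" by simp
      then have "P dvd q'" using qr by (simp add: dvd_add_left_iff)
      then show False using no_prime P \<open>P dvd r'\<close> by blast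
    qed
    from coprime_product_square[OF this conic] obtain s u v where
      s: "s = 1 \<or> s = -1" and p: "p = s * u ^ 2" and qr: "- (q' + r') = s * v ^ 2"
      and w: "q' + 2 * r' = u * v" .
    have r'': "r' = s * v ^ 2 + u * v" and q'': "q' = - (u * v) - 2 * s * v ^ 2"
      using qr w by simp_all
    have "coprime u v"
    proof (rule coprime_by_primes)
      fix P :: int assume P: "Factorial_Ring.prime P" "P dvd u" "P dvd v"
      then show False using no_prime[of P] unfolding p q'' r'' by (simp add: power2_eq_square)
    qed
    then have "coprime (s * u) v" using s by auto
    define t where "t = s * u"
    have ct: "coprime t v" using \<open>coprime (s * u) v\<close> unfolding t_def .
    \<comment> \<open>With w = t + v the second factor is w^3 - w^2 v + w v^2 + v^3, the original
      cubic form at (w, -v). Once -v = s' m^2, the value b = s' w = s' t - m^2 gives a point of the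
      same curve.\<close>
    have "- v * (t ^ 3 + v * (2 * t ^ 2 + 2 * t * v + 2 * v ^ 2)) = e' ^ 2"
      using s unfolding B' p q'' r'' t_def by (auto simp: eval_nat_numeral algebra_simps)
    moreover have "coprime (- v) (t ^ 3 + v * (2 * t ^ 2 + 2 * t * v + 2 * v ^ 2))"
    proof (rule coprime_by_primes)
      fix P :: int
      assume P: "Factorial_Ring.prime P" "P dvd - v"
        "P dvd t ^ 3 + v * (2 * t ^ 2 + 2 * t * v + 2 * v ^ 2)"
      then have "P dvd v" "P dvd t ^ 3" by (simp_all add: dvd_add_left_iff)
      then have "P dvd t" using P(1) prime_dvd_power by blast
      with \<open>P dvd v\<close> show False using ct P(1) by (meson coprime_common_divisor not_prime_unit)
    qed
    ultimately obtain s' m n where s': "s' = 1 \<or> s' = -1" and m: "- v = s' * m ^ 2"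
      and n: "t ^ 3 + v * (2 * t ^ 2 + 2 * t * v + 2 * v ^ 2) = s' * n ^ 2" and e'': "e' = m * n"
      using coprime_product_square by metis
    have v: "v = - s' * m ^ 2" using m by simp
    show ?thesis
    proof (rule that)
      show "e = 2 * (m * n) \<or> e = - 2 * (m * n)" unfolding e' e'' by simp
      have "coprime (s' * t) (m ^ 2)" using ct s' unfolding v by auto
      then have "coprime (s' * t) m" by simp
      then show "coprime (s' * t - m ^ 2) m"
      proof (intro coprime_by_primes)
        fix P :: int
        assume cop: "coprime (s' * t) m" and P: "Factorial_Ring.prime P" "P dvd s' * t - m ^ 2" "P dvd m"
        have "P dvd (s' * t - m ^ 2) + m ^ 2" using P by (intro dvd_add) (simp_all add: power2_eq_square)
        then have "P dvd s' * t" by simp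
        with cop P show False by (meson coprime_common_divisor not_prime_unit)
      qed
      show "(s' * t - m ^ 2) ^ 3 + (s' * t - m ^ 2) ^ 2 * m ^ 2 + (s' * t - m ^ 2) * m ^ 4 - m ^ 6 = n ^ 2"
        using s' n unfolding v by (auto simp: eval_nat_numeral algebra_simps)
    qed
  qed
qed

text \<open>A nonzero e = 2 m n or -2 m n gives a point with nonzero m and |m| < |e|, so only the
  point at infinity can occur.\<close>

lemma second_curve_integral_points:
  fixes a e k :: int
  assumes "coprime a e" "a ^ 3 + a ^ 2 * e ^ 2 + a * e ^ 4 - e ^ 6 = k ^ 2"
  shows "e = 0"
  using assms
proof (induction "nat \<bar>e\<bar>" arbitrary: a e k rule: less_induct)
  case less
  obtain m n b where e: "e = 2 * (m * n) \<or> e = - 2 * (m * n)" and b: "coprime b m"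
    "b ^ 3 + b ^ 2 * m ^ 2 + b * m ^ 4 - m ^ 6 = n ^ 2"
    using second_descent[OF less.prems] .
  show ?case
  proof (rule ccontr)
    assume "e \<noteq> 0"
    then have mn: "m \<noteq> 0" "n \<noteq> 0" using e by auto
    have "\<bar>m\<bar> * 1 \<le> \<bar>m\<bar> * \<bar>n\<bar>" using mn by (intro mult_left_mono) auto
    then have "\<bar>m\<bar> < \<bar>e\<bar>" using e mn by (auto simp: abs_mult)
    then have "m = 0" using less.hyps[of m b n] b by simp
    with mn show False by simp
  qed
qed

section \<open>From integers to rational abscissas\<close>

lemma rat_square_int:
  fixes r :: rat
  assumes "r ^ 2 = of_int n"
  obtains k where "r = of_int k" "n = k ^ 2"
proof -
  obtain a b where ab: "quotient_of r = (a, b)" by (cases "quotient_of r")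
  then have b: "b > 0" and cop: "coprime a b" and r: "r = of_int a / of_int b"
    using quotient_of_denom_pos quotient_of_coprime quotient_of_div by blast+
  have "of_int (a ^ 2) = (of_int (n * b ^ 2) :: rat)"
    using assms b unfolding r by (simp add: field_simps)
  then have "a ^ 2 = n * b ^ 2" by (simp only: of_int_eq_iff)
  then have "b dvd a ^ 2" by (simp add: power2_eq_square)
  moreover have "coprime (a ^ 2) b" using cop by simp
  ultimately have "is_unit b" by (meson coprime_common_divisor dvd_refl)
  then have "b = 1" using b by simp
  then show ?thesis using that[of a] r \<open>a ^ 2 = n * b ^ 2\<close> by simp
qed

lemma rat_square_not_between:
  fixes r :: rat
  assumes "0 \<le> n" "n ^ 2 < c" "c < (n + 1) ^ 2"
  shows "r ^ 2 \<noteq> of_int c"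
proof
  assume "r ^ 2 = of_int c"
  then obtain k where "c = k ^ 2" by (rule rat_square_int)
  then have "n ^ 2 < \<bar>k\<bar> ^ 2" "\<bar>k\<bar> ^ 2 < (n + 1) ^ 2" using assms by simp_all
  then have "n < \<bar>k\<bar>" "\<bar>k\<bar> < n + 1"
    using assms(1) by (meson abs_ge_zero power_less_imp_less_base add_nonneg_nonneg zero_le_one)+
  then show False by linarith
qed

text \<open>5 and 48 arise when the equations for p and q are eliminated; 2, 17 and 34 = 2 * 17 are
  needed for the two exceptional fields.\<close>

lemma no_rat_sqrt:
  fixes r :: rat
  shows "r ^ 2 \<noteq> 2" "r ^ 2 \<noteq> 5" "r ^ 2 \<noteq> 17" "r ^ 2 \<noteq> 34" "r ^ 2 \<noteq> 48"
  using rat_square_not_between[of 1 2 r] rat_square_not_between[of 2 5 r]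
    rat_square_not_between[of 4 17 r] rat_square_not_between[of 5 34 r]
    rat_square_not_between[of 6 48 r]
  by simp_all

lemma prime_dvd_2: "Factorial_Ring.prime P \<Longrightarrow> P dvd 2 \<Longrightarrow> P = (2 :: int)"
  by (rule primes_dvd_imp_eq) simp_all

lemma E_rational_points:
  fixes x y :: rat
  assumes "y ^ 2 = 2 * (x ^ 3 + x ^ 2 - x + 1)"
  shows "x = 1 \<or> x = -1"
proof -
  \<comment> \<open>\<open>X = (x + 1) / 2\<close> and \<open>Y = y / 2\<close> satisfy \<open>Y\<^sup>2 = 4 X\<^sup>3 - 4 X\<^sup>2 + 1\<close>.\<close>
  obtain A b where "quotient_of ((x + 1) / 2) = (A, b)" by (cases "quotient_of ((x + 1) / 2)")
  then have b: "b > 0" and cop: "coprime A b" and "(x + 1) / 2 = of_int A / of_int b"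
    using quotient_of_denom_pos quotient_of_coprime quotient_of_div by blast+
  then have x: "x = 2 * of_int A / of_int b - 1" by (simp add: field_simps)
  have "(of_int b ^ 2 * y / 2) ^ 2 = of_int b ^ 4 * (y ^ 2) / 4"
    by (simp add: power_mult_distrib power_divide flip: power_mult)
  also have "\<dots> = of_int (b * (4 * A ^ 3 - 4 * A ^ 2 * b + b ^ 3))"
    unfolding assms x using b by (simp add: field_simps eval_nat_numeral)
  finally obtain n where n: "b * (4 * A ^ 3 - 4 * A ^ 2 * b + b ^ 3) = n ^ 2"
    by (rule rat_square_int)
  have "\<exists>l k. b = l ^ 2 \<and> 4 * A ^ 3 - 4 * A ^ 2 * l ^ 2 + l ^ 6 = k ^ 2"
  proof (cases "even b")
    case False
    have "coprime b (4 * A ^ 3 - 4 * A ^ 2 * b + b ^ 3)"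
    proof (rule coprime_by_primes)
      fix P :: int
      assume P: "Factorial_Ring.prime P" "P dvd b" "P dvd 4 * A ^ 3 - 4 * A ^ 2 * b + b ^ 3"
      have "P dvd b ^ 3 - 4 * A ^ 2 * b" using P(2) by (simp add: power3_eq_cube)
      then have "P dvd (4 * A ^ 3 - 4 * A ^ 2 * b + b ^ 3) - (b ^ 3 - 4 * A ^ 2 * b)"
        by (rule dvd_diff[OF P(3)])
      then have "P dvd 2 ^ 2 * A ^ 3" by simp
      then have "P dvd 2 \<or> P dvd A" using P(1) by (metis prime_dvd_mult_iff prime_dvd_power)
      moreover have "\<not> P dvd 2"
        using P(1,2) False by (metis prime_dvd_2)
      ultimately show False using P cop by (meson coprime_common_divisor not_prime_unit)
    qed
    from coprime_product_square[OF this n] obtain s m k where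
      s: "s = 1 \<or> s = -1" "b = s * m ^ 2" "4 * A ^ 3 - 4 * A ^ 2 * b + b ^ 3 = s * k ^ 2" .
    have "s = 1" using s(1,2) b by (auto simp: zero_less_mult_iff)
    then show ?thesis using s(2,3) by (intro exI[of _ m] exI[of _ k]) (simp flip: power_mult)
  next
    case True
    \<comment> \<open>For even b the factors are not coprime. Parity yields b = 4 d, and d and a
      quarter of the second factor are coprime, so b is a square here too.\<close>
    then obtain c where c: "b = 2 * c" by (elim evenE)
    have A: "odd A" using True cop by (metis coprime_common_divisor odd_one)
    have n8: "n ^ 2 = 8 * (c * (A ^ 3 - 2 * A ^ 2 * c + 2 * c ^ 3))"
      unfolding n[symmetric] c by (simp add: eval_nat_numeral algebra_simps)
    then have "even (n ^ 2)" by simp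
    then obtain n1 where n1: "n = 2 * n1" by (auto elim: evenE)
    have n1': "n1 ^ 2 = 2 * (c * (A ^ 3 - 2 * A ^ 2 * c + 2 * c ^ 3))"
      using n8 unfolding n1 by (simp add: power_mult_distrib)
    then have "even (n1 ^ 2)" by simp
    then obtain n2 where n2: "n1 = 2 * n2" by (auto elim: evenE)
    have n2': "2 * n2 ^ 2 = c * (A ^ 3 - 2 * A ^ 2 * c + 2 * c ^ 3)"
      using n1' unfolding n2 by (simp add: power_mult_distrib)
    have "even (c * (A ^ 3 - 2 * A ^ 2 * c + 2 * c ^ 3))" unfolding n2'[symmetric] by simp
    then have "even c" using A by simp
    then obtain d where d: "c = 2 * d" by (elim evenE)
    have n3: "d * (A ^ 3 - 4 * A ^ 2 * d + 16 * d ^ 3) = n2 ^ 2"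
      using n2' unfolding d by (simp add: eval_nat_numeral algebra_simps)
    have "coprime d (A ^ 3 - 4 * A ^ 2 * d + 16 * d ^ 3)"
    proof (rule coprime_by_primes)
      fix P :: int
      assume P: "Factorial_Ring.prime P" "P dvd d" "P dvd A ^ 3 - 4 * A ^ 2 * d + 16 * d ^ 3"
      have "P dvd 16 * d ^ 3 - 4 * A ^ 2 * d" using P(2) by (simp add: power3_eq_cube)
      then have "P dvd (A ^ 3 - 4 * A ^ 2 * d + 16 * d ^ 3) - (16 * d ^ 3 - 4 * A ^ 2 * d)"
        by (rule dvd_diff[OF P(3)])
      then have "P dvd A ^ 3" by simp
      then have "P dvd A" using P(1) prime_dvd_power by blast
      moreover have "P dvd b" using P(2) unfolding c d by simp
      ultimately show False using P(1) cop by (meson coprime_common_divisor not_prime_unit)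
    qed
    from coprime_product_square[OF this n3] obtain s m k where
      s: "s = 1 \<or> s = -1" "d = s * m ^ 2" "A ^ 3 - 4 * A ^ 2 * d + 16 * d ^ 3 = s * k ^ 2" .
    have "s = 1" using s(1,2) b unfolding c d by (auto simp: zero_less_mult_iff)
    then have d': "d = m ^ 2" "A ^ 3 - 4 * A ^ 2 * d + 16 * d ^ 3 = k ^ 2" using s by auto
    have "4 * A ^ 3 - 4 * A ^ 2 * (2 * m) ^ 2 + (2 * m) ^ 6 = 4 * (A ^ 3 - 4 * A ^ 2 * d + 16 * d ^ 3)"
      unfolding d'(1) by (simp add: eval_nat_numeral)
    also have "\<dots> = (2 * k) ^ 2" unfolding d'(2) by (simp add: power_mult_distrib)
    finally show ?thesis unfolding c d d'(1)
      by (intro exI[of _ "2 * m"] exI[of _ "2 * k"]) (simp add: power_mult_distrib)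
  qed
  then obtain l k where l: "b = l ^ 2" "4 * A ^ 3 - 4 * A ^ 2 * l ^ 2 + l ^ 6 = k ^ 2" by blast
  then have "coprime A l" "l \<noteq> 0" using cop b by auto
  then have "A = 0 \<or> A = 1 \<and> b = 1" using X_integral_points[OF _ l(2)] l(1) by metis
  then show ?thesis unfolding x by auto
qed

text \<open>This handles rational x with y and z multiples of one square root, z = t y. Writing x =
  a/b turns the relation into a square product of F and b a G, whose only possible common prime is
  2. An odd F contradicts the second descent, and an even F makes y rational.\<close>

lemma twisted_square:
  fixes x t :: rat
  assumes t: "t ^ 2 * (x ^ 3 + x ^ 2 - x + 1) = x * (x ^ 3 + x ^ 2 + x - 1)" and "x \<noteq> 0"
  obtains y where "y ^ 2 = 2 * (x ^ 3 + x ^ 2 - x + 1)"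
proof -
  obtain a b where "quotient_of x = (a, b)" by (cases "quotient_of x")
  then have b: "b > 0" and cop: "coprime a b" and x: "x = of_int a / of_int b"
    using quotient_of_denom_pos quotient_of_coprime quotient_of_div by blast+
  have a: "a \<noteq> 0" using \<open>x \<noteq> 0\<close> x by auto
  define F G where "F = a ^ 2 * (a + b) + b ^ 2 * (b - a)" and "G = a ^ 2 * (a + b) - b ^ 2 * (b - a)"
  have f: "x ^ 3 + x ^ 2 - x + 1 = of_int F / of_int b ^ 3"
    unfolding x F_def using b by (simp add: field_simps eval_nat_numeral)
  have g: "x ^ 3 + x ^ 2 + x - 1 = of_int G / of_int b ^ 3"
    unfolding x G_def using b by (simp add: field_simps eval_nat_numeral)
  have tF: "t ^ 2 * of_int (F * b) = of_int (a * G)"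
    using t b unfolding f g unfolding x by (simp add: field_simps eval_nat_numeral)
  \<comment> \<open>Positivity fixes the sign when F, or its half, is later recognised as a square.
    F = 0 forces G = 0, and F < 0 forces a < 0 and G < 0, against \<open>tF\<close>.\<close>
  have "F > 0"
  proof (rule ccontr)
    assume "\<not> F > 0"
    then consider "F = 0" | "F < 0" by linarith
    then show False
    proof cases
      case 1
      then have "a * G = 0" using tF by simp
      then have "G = 0" using a by simp
      moreover have "2 * (a ^ 2 * (a + b)) = F + G" unfolding F_def G_def by simp
      ultimately have "a ^ 2 * (a + b) = 0" using 1 by simp
      then have "b = - a" using a by simp
      then show False using 1 a unfolding F_def by simp
    next
      case 2
      have "a < 0"
      proof (rule ccontr)
        assume "\<not> a < 0"
        then have "a ^ 3 + b * ((a - b) ^ 2 + a * b) \<ge> 0" using b by simp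
        also have "a ^ 3 + b * ((a - b) ^ 2 + a * b) = F"
          unfolding F_def by (simp add: eval_nat_numeral algebra_simps)
        finally show False using 2 by simp
      qed
      then have "b ^ 2 * (b - a) > 0" using b by simp
      then have "G < 0" using 2 unfolding F_def G_def by linarith
      then have "a * G > 0" using \<open>a < 0\<close> by (simp add: mult_neg_neg)
      moreover have "t ^ 2 * of_int (F * b) \<le> 0"
        using 2 b by (intro mult_nonneg_nonpos) (simp_all add: mult_le_0_iff)
      ultimately show False unfolding tF by simp
    qed
  qed
  have "(t * of_int (F * b)) ^ 2 = t ^ 2 * of_int (F * b) * of_int (F * b)"
    by (simp add: power2_eq_square)
  also have "\<dots> = of_int (F * (b * (a * G)))" unfolding tF by (simp add: mult_ac)
  finally obtain w where w: "F * (b * (a * G)) = w ^ 2" by (rule rat_square_int)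
  \<comment> \<open>A common odd prime divides neither a nor b, hence divides G, and then F + G = 2
    a^2 (a + b) and F - G = 2 b^2 (b - a), and so 2 a.\<close>
  have odd_prime: False
    if P: "Factorial_Ring.prime P" "P \<noteq> 2" "P dvd F" "P dvd b * (a * G)" for P
  proof -
    have ab: False if "P dvd a" "P dvd b"
      using that cop P(1) by (meson coprime_common_divisor not_prime_unit)
    have Pa: "\<not> P dvd a"
    proof
      assume "P dvd a"
      moreover have "b ^ 3 = F - a * (a * (a + b) - b ^ 2)"
        unfolding F_def by (simp add: eval_nat_numeral algebra_simps)
      then have "P dvd b ^ 3" using \<open>P dvd a\<close> P(3) by (metis dvd_diff dvd_mult2)
      ultimately show False using ab P(1) prime_dvd_power by blast
    qed
    have Pb: "\<not> P dvd b"
    proof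
      assume "P dvd b"
      moreover have "a ^ 3 = F - b * (a ^ 2 + b * (b - a))"
        unfolding F_def by (simp add: eval_nat_numeral algebra_simps)
      then have "P dvd a ^ 3" using \<open>P dvd b\<close> P(3) by (metis dvd_diff dvd_mult2)
      ultimately show False using ab P(1) prime_dvd_power by blast
    qed
    have "P dvd G" using P(1,4) Pa Pb by (simp add: prime_dvd_mult_iff)
    then have "P dvd F + G" "P dvd F - G" using P(3) by simp_all
    moreover have "F + G = 2 * (a ^ 2 * (a + b))" "F - G = 2 * (b ^ 2 * (b - a))"
      unfolding F_def G_def by simp_all
    ultimately have "P dvd 2 * (a ^ 2 * (a + b))" "P dvd 2 * (b ^ 2 * (b - a))" by simp_all
    moreover have P2: "\<not> P dvd 2" using P(1,2) by (metis prime_dvd_2)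
    ultimately have "P dvd a + b" "P dvd b - a"
      using Pa Pb P(1) by (auto simp: prime_dvd_mult_iff prime_dvd_power_iff)
    then have "P dvd (a + b) - (b - a)" by (rule dvd_diff)
    then have "P dvd 2 * a" by simp
    then show False using Pa P2 P(1) by (simp add: prime_dvd_mult_iff)
  qed
  have cop_b: "coprime b (a * G)"
  proof (rule coprime_by_primes)
    fix P :: int assume P: "Factorial_Ring.prime P" "P dvd b" "P dvd a * G"
    have "\<not> P dvd a" using P cop by (meson coprime_common_divisor not_prime_unit)
    then have "P dvd G" using P by (simp add: prime_dvd_mult_iff)
    have "a ^ 3 = G - b * (a ^ 2 - b * (b - a))"
      unfolding G_def by (simp add: eval_nat_numeral algebra_simps)
    then have "P dvd a ^ 3" using \<open>P dvd G\<close> P(2) by (metis dvd_diff dvd_mult2)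
    then show False using \<open>\<not> P dvd a\<close> P(1) prime_dvd_power by blast
  qed
  have cop_a: "coprime a G"
  proof (rule coprime_by_primes)
    fix P :: int assume P: "Factorial_Ring.prime P" "P dvd a" "P dvd G"
    have "b ^ 3 = a * (a * (a + b) + b ^ 2) - G"
      unfolding G_def by (simp add: eval_nat_numeral algebra_simps)
    then have "P dvd b ^ 3" using P(2,3) by (metis dvd_diff dvd_mult2)
    then have "P dvd b" using P(1) prime_dvd_power by blast
    then show False using P cop by (meson coprime_common_divisor not_prime_unit)
  qed
  show ?thesis
  proof (cases "even F")
    \<comment> \<open>Now F and b are squares, so y would lie in \<rat>(sqrt 2). Depending on the
      sign of a, either a/b = x or -b/a = -1/x is the abscissa of an affine point on the second
      curve.\<close>
    case False
    have "coprime F (b * (a * G))"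
      using odd_prime False by (intro coprime_by_primes) blast
    from coprime_product_square[OF this w] obtain s n1 n2 where
      s: "s = 1 \<or> s = -1" "F = s * n1 ^ 2" "b * (a * G) = s * n2 ^ 2" .
    have "s = 1" using s(1,2) \<open>F > 0\<close> by (auto simp: zero_less_mult_iff)
    then have F: "F = n1 ^ 2" and n2: "b * (a * G) = n2 ^ 2" using s by auto
    from coprime_product_square[OF cop_b n2] obtain s e n3 where
      s: "s = 1 \<or> s = -1" "b = s * e ^ 2" "a * G = s * n3 ^ 2" .
    have "s = 1" using s(1,2) b by (auto simp: zero_less_mult_iff)
    then have e: "b = e ^ 2" and n3: "a * G = n3 ^ 2" using s by auto
    from coprime_product_square[OF cop_a n3] obtain s r n4 where
      s: "s = 1 \<or> s = -1" and r: "a = s * r ^ 2" and n4: "G = s * n4 ^ 2" .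
    show ?thesis using s
    proof
      assume "s = 1"
      then have "a ^ 3 + a ^ 2 * e ^ 2 + a * e ^ 4 - e ^ 6 = n4 ^ 2"
        using n4 unfolding G_def e by (simp add: eval_nat_numeral algebra_simps)
      moreover have "coprime a e" using cop unfolding e by simp
      ultimately have "e = 0" by (intro second_curve_integral_points)
      then show ?thesis using e b by simp
    next
      assume "s = -1"
      then have "b ^ 3 + b ^ 2 * r ^ 2 + b * r ^ 4 - r ^ 6 = n1 ^ 2"
        using F unfolding F_def r by (simp add: eval_nat_numeral algebra_simps)
      moreover have "coprime b r" using cop \<open>s = -1\<close> unfolding r by (simp add: coprime_commute)
      ultimately have "r = 0" by (intro second_curve_integral_points)
      then show ?thesis using r a by simp
    qed
  next
    \<comment> \<open>F and G are both even; after removing 2 the factors are coprime, so F/2 and b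
      are squares and 2 F / b^3 is one as well.\<close>
    case True
    then have "even (a + b)" unfolding F_def by auto
    then have ab: "odd a" "odd b" using cop by (metis coprime_common_divisor even_add odd_one)+
    obtain m where m: "a + b = 2 * m" using \<open>even (a + b)\<close> by (elim evenE)
    have "even (b - a)" using ab by simp
    then obtain n where n: "b - a = 2 * n" by (elim evenE)
    have "odd (m + n)" using m n ab by presburger
    define F' G' where "F' = a ^ 2 * m + b ^ 2 * n" and "G' = a ^ 2 * m - b ^ 2 * n"
    have F: "F = 2 * F'" and G: "G = 2 * G'"
      unfolding F_def G_def F'_def G'_def m n by (simp_all add: algebra_simps)
    have "odd F'" unfolding F'_def using ab \<open>odd (m + n)\<close> by simp
    have w4: "w ^ 2 = 2 * (2 * (F' * (b * (a * G'))))"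
      unfolding w[symmetric] F G by (simp add: mult_ac)
    then have "even (w ^ 2)" by simp
    then obtain w' where w': "w = 2 * w'" by (auto elim: evenE)
    have w'2: "F' * (b * (a * G')) = w' ^ 2" using w4 unfolding w' by (simp add: power_mult_distrib)
    have "coprime F' (b * (a * G'))"
    proof (rule coprime_by_primes)
      fix P :: int assume P: "Factorial_Ring.prime P" "P dvd F'" "P dvd b * (a * G')"
      have "P \<noteq> 2" using P(2) \<open>odd F'\<close> by auto
      moreover have "P dvd F" using P(2) unfolding F by simp
      moreover have "b * (a * G) = 2 * (b * (a * G'))" unfolding G by (simp add: mult_ac)
      then have "P dvd b * (a * G)" using P(3) by (metis dvd_mult)
      ultimately show False using odd_prime P(1) by blast
    qed
    from coprime_product_square[OF this w'2] obtain s n1 n2 where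
      s: "s = 1 \<or> s = -1" "F' = s * n1 ^ 2" "b * (a * G') = s * n2 ^ 2" .
    have "s = 1" using s(1,2) \<open>F > 0\<close> unfolding F by (auto simp: zero_less_mult_iff)
    then have F': "F' = n1 ^ 2" and n2: "b * (a * G') = n2 ^ 2" using s by auto
    have "coprime b (a * G')"
      using cop_b unfolding G by (simp add: mult.left_commute)
    from coprime_product_square[OF this n2] obtain s e n3 where
      s: "s = 1 \<or> s = -1" "b = s * e ^ 2" "a * G' = s * n3 ^ 2" .
    have "s = 1" using s(1,2) b by (auto simp: zero_less_mult_iff)
    then have e: "b = e ^ 2" using s by auto
    have "(2 * of_int n1 / of_int e ^ 3 :: rat) ^ 2 = 2 * (x ^ 3 + x ^ 2 - x + 1)"
      unfolding f F F' e by (simp add: power_divide power_mult_distrib flip: power_mult)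
    then show ?thesis by (rule that)
  qed
qed

section \<open>Quadratic points\<close>

text \<open>The hypotheses say that \<open>y = \<alpha> x + \<beta>\<close> satisfies the equation of \<open>E\<close> modulo \<open>x\<^sup>2 + p x + q\<close>;
  they are its coefficients at \<open>x\<close> and \<open>1\<close>.\<close>

lemma irrational_point_on_E:
  fixes p q \<alpha> \<beta> :: rat
  assumes 1: "2 * \<alpha> * \<beta> - p * \<alpha> ^ 2 = 2 * (p ^ 2 - q - p - 1)"
    and 0: "\<beta> ^ 2 - q * \<alpha> ^ 2 = 2 * (p * q - q + 1)"
  shows "(3 - p - q) ^ 2 = 16 - 8 * p \<or> (p - q - 1) ^ 2 = - 8 * p"
proof -
  \<comment> \<open>the abscissa of the third intersection of the line \<open>y = \<alpha> x + \<beta>\<close> with \<open>E\<close>\<close>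
  define c where "c = p - 1 + \<alpha> ^ 2 / 2"
  have \<alpha>: "\<alpha> ^ 2 = 2 * (c - p + 1)" unfolding c_def by simp
  have "(\<alpha> * c + \<beta>) ^ 2 = \<alpha> ^ 2 * c ^ 2 + (2 * \<alpha> * \<beta>) * c + \<beta> ^ 2"
    by (simp add: power2_eq_square algebra_simps)
  also have "\<dots> = 2 * (c ^ 3 + c ^ 2 - c + 1)"
  proof -
    have ab: "2 * \<alpha> * \<beta> = p * \<alpha> ^ 2 + 2 * (p ^ 2 - q - p - 1)" using 1 by simp
    have b2: "\<beta> ^ 2 = q * \<alpha> ^ 2 + 2 * (p * q - q + 1)" using 0 by simp
    show ?thesis unfolding ab b2 unfolding \<alpha> by (simp add: eval_nat_numeral algebra_simps)
  qed
  finally have pt: "(\<alpha> * c + \<beta>) ^ 2 = 2 * (c ^ 3 + c ^ 2 - c + 1)" .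
  then have c: "c = 1 \<or> c = -1" by (rule E_rational_points)
  define s where "s = \<alpha> * c + \<beta>"
  have s2: "s ^ 2 = 4" using pt c unfolding s_def by auto
  have s: "s ^ 2 * \<alpha> ^ 2 = 4 * \<alpha> ^ 2" unfolding s2 ..
  have \<beta>: "\<beta> = s - \<alpha> * c" unfolding s_def by simp
  \<comment> \<open>Eliminating \<beta> makes s \<alpha> linear in p and q. Squaring, with s^2 = 4
    and \<alpha>^2 linear in p, removes s and \<alpha>.\<close>
  show ?thesis using c
  proof
    assume c: "c = 1"
    have "2 * \<alpha> * s = p * \<alpha> ^ 2 + 2 * \<alpha> ^ 2 + 2 * (p ^ 2 - q - p - 1)"
      using 1 unfolding \<beta> c by (simp add: power2_eq_square algebra_simps)
    then have "s * \<alpha> = 3 - p - q" unfolding \<alpha> c by (simp add: power2_eq_square algebra_simps)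
    then have "(3 - p - q) ^ 2 = 4 * \<alpha> ^ 2" using s by (metis power_mult_distrib)
    then show ?thesis unfolding \<alpha> c by simp
  next
    assume c: "c = -1"
    have "2 * \<alpha> * s = p * \<alpha> ^ 2 - 2 * \<alpha> ^ 2 + 2 * (p ^ 2 - q - p - 1)"
      using 1 unfolding \<beta> c by (simp add: power2_eq_square algebra_simps)
    then have "s * \<alpha> = p - q - 1" unfolding \<alpha> c by (simp add: power2_eq_square algebra_simps)
    then have "(p - q - 1) ^ 2 = 4 * \<alpha> ^ 2" using s by (metis power_mult_distrib)
    then show ?thesis unfolding \<alpha> c by simp
  qed
qed

text \<open>Hypothesis \<open>B\<close> is \<open>A\<close> for the minimal polynomial \<open>u\<^sup>2 - (p/q) u + 1/q\<close> of \<open>u = -1/x\<close>. Among the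
  solutions only the first one belongs to an irreducible quadratic polynomial.\<close>

lemma matching_quadratics:
  fixes p q :: rat
  assumes A: "(3 - p - q) ^ 2 = 16 - 8 * p \<or> (p - q - 1) ^ 2 = - 8 * p"
    and B: "(3 * q + p - 1) ^ 2 = 16 * q ^ 2 + 8 * p * q \<or> (p + q + 1) ^ 2 = 8 * p * q"
    and q: "q \<noteq> 0"
  shows "p = -8 \<and> q = -1 \<or> p = 0 \<and> q = -1 \<or> p = 2 \<and> q = 1 \<or> p = -2 \<and> q = 1"
  using A
proof
  assume A1: "(3 - p - q) ^ 2 = 16 - 8 * p"
  show ?thesis using B
  proof
    assume B1: "(3 * q + p - 1) ^ 2 = 16 * q ^ 2 + 8 * p * q"
    define s where "s = p + q"
    have p: "p = s - q" unfolding s_def by simp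
    have q8: "8 * q = s ^ 2 + 2 * s - 7" using A1 unfolding p by (simp add: power2_eq_square algebra_simps)
    have "16 * s ^ 2 - 8 * s * (8 * q) - (8 * q) ^ 2 - 8 * (8 * q) - 32 * s + 16 = 0"
      using B1 unfolding p by (simp add: power2_eq_square algebra_simps)
    \<comment> \<open>Eliminating q leaves a quartic in s; its quadratic factor has no rational root
      since 48 is not a rational square. The other cases work alike, with 5 where a quadratic factor
      appears.\<close>
    then have "(s + 1) ^ 2 * ((s + 5) ^ 2 - 48) = 0"
      unfolding q8 by (simp add: eval_nat_numeral algebra_simps)
    then have "s = -1" using no_rat_sqrt(5)[of "s + 5"] by (simp add: eq_neg_iff_add_eq_0)
    then show ?thesis using q8 p by simp
  next
    assume B2: "(p + q + 1) ^ 2 = 8 * p * q"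
    have pq: "p * q = q + 1" and s: "(p + q + 1) ^ 2 = 8 * (q + 1)"
      using A1 B2 by (simp_all add: power2_eq_square algebra_simps)
    have "(p * q + q ^ 2 + q) ^ 2 = q ^ 2 * (p + q + 1) ^ 2" by (simp add: power2_eq_square algebra_simps)
    then have "(q + 1) * ((q - 1) * ((q - 2) ^ 2 - 5)) = 0"
      unfolding pq s by (simp add: eval_nat_numeral algebra_simps)
    then have "q = -1 \<or> q = 1" using no_rat_sqrt(2)[of "q - 2"] by (auto simp: eq_neg_iff_add_eq_0)
    then show ?thesis using pq by auto
  qed
next
  assume A2: "(p - q - 1) ^ 2 = - 8 * p"
  show ?thesis using B
  proof
    assume B1: "(3 * q + p - 1) ^ 2 = 16 * q ^ 2 + 8 * p * q"
    have p: "p = - (q * (q + 1))"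
      using A2 B1 by (simp add: power2_eq_square algebra_simps)
    have "(q + 1) * ((q - 1) * ((q + 2) ^ 2 - 5)) = 0"
      using A2 unfolding p by (simp add: eval_nat_numeral algebra_simps)
    then have "q = -1 \<or> q = 1" using no_rat_sqrt(2)[of "q + 2"] by (auto simp: eq_neg_iff_add_eq_0)
    then show ?thesis using p by auto
  next
    assume B2: "(p + q + 1) ^ 2 = 8 * p * q"
    have "p * (q + 1) = 0"
      using A2 B2 by (simp add: power2_eq_square algebra_simps)
    then have "p = 0 \<or> q = -1" by (auto simp: eq_neg_iff_add_eq_0)
    then show ?thesis
    proof
      assume p: "p = 0"
      then have "(q + 1) ^ 2 = 0" using B2 by simp
      then show ?thesis using p by (simp add: eq_neg_iff_add_eq_0)
    next
      assume q: "q = -1"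
      then have "p * (p + 8) = 0" using A2 by (simp add: power2_eq_square algebra_simps)
      then show ?thesis using q by (auto simp: eq_neg_iff_add_eq_0)
    qed
  qed
qed

section \<open>Points over a field of degree at most two\<close>

lemmas of_rat_hom = of_rat_add of_rat_diff of_rat_mult of_rat_power of_rat_minus

lemma E_Rats_points:
  fixes x y :: "'a::field_char_0"
  assumes "x \<in> \<rat>" "y \<in> \<rat>" "y ^ 2 = 2 * (x ^ 3 + x ^ 2 - x + 1)"
  shows "x = 1 \<or> x = -1"
proof -
  obtain r s where rs: "x = of_rat r" "y = of_rat s" using assms(1,2) by (auto elim!: Rats_cases)
  have "of_rat (s ^ 2) = (of_rat (2 * (r ^ 3 + r ^ 2 - r + 1)) :: 'a)"
    using assms(3) unfolding rs by (simp add: of_rat_hom)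
  then have "r = 1 \<or> r = -1" by (intro E_rational_points) (simp only: of_rat_eq_iff)
  then show ?thesis unfolding rs by auto
qed

lemma Rats_independent:
  fixes x :: "'a::field_char_0"
  assumes "x \<notin> \<rat>" "a \<in> \<rat>" "b \<in> \<rat>" "a + b * x = 0"
  shows "a = 0" "b = 0"
proof -
  show "b = 0"
  proof (rule ccontr)
    assume "b \<noteq> 0"
    then have "x = - a / b" using assms(4) by (simp add: field_simps eq_neg_iff_add_eq_0)
    then show False using assms by simp
  qed
  then show "a = 0" using assms(4) by simp
qed

lemma irrational_point_on_E_field:
  fixes x y :: "'a::field_char_0"
  assumes x: "x \<notin> \<rat>" "x ^ 2 + of_rat p * x + of_rat q = 0"
    and y: "y = of_rat \<beta> + of_rat \<alpha> * x" "y ^ 2 = 2 * (x ^ 3 + x ^ 2 - x + 1)"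
  shows "(3 - p - q) ^ 2 = 16 - 8 * p \<or> (p - q - 1) ^ 2 = - 8 * p"
proof -
  define P Q A B :: 'a where "P = of_rat p" and "Q = of_rat q" and "A = of_rat \<alpha>" and "B = of_rat \<beta>"
  have "(B ^ 2 - Q * A ^ 2 - 2 * (P * Q - Q + 1)) +
      (2 * A * B - P * A ^ 2 - 2 * (P ^ 2 - Q - P - 1)) * x = 0"
    using x(2) y unfolding P_def[symmetric] Q_def[symmetric] A_def[symmetric] B_def[symmetric]
    by Groebner_Basis.algebra
  then have "of_rat (\<beta> ^ 2 - q * \<alpha> ^ 2 - 2 * (p * q - q + 1)) +
      of_rat (2 * \<alpha> * \<beta> - p * \<alpha> ^ 2 - 2 * (p ^ 2 - q - p - 1)) * x = 0"
    unfolding P_def Q_def A_def B_def by (simp add: of_rat_hom)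
  from Rats_independent[OF x(1) _ _ this]
  have "\<beta> ^ 2 - q * \<alpha> ^ 2 - 2 * (p * q - q + 1) = 0"
    "2 * \<alpha> * \<beta> - p * \<alpha> ^ 2 - 2 * (p ^ 2 - q - p - 1) = 0"
    by simp_all
  then show ?thesis by (intro irrational_point_on_E[of \<alpha> \<beta>]) simp_all
qed

text \<open>The consequences of being a subfield of degree at most \<open>2\<close> over \<open>\<rat>\<close> that are needed.\<close>

definition rational_plane :: "'a::field_char_0 set \<Rightarrow> bool" where
  "rational_plane K \<longleftrightarrow> \<rat> \<subseteq> K \<and> (\<forall>x\<in>K. \<forall>y\<in>K. x * y \<in> K) \<and> (\<forall>x\<in>K. inverse x \<in> K) \<and>
     (\<forall>x\<in>K - \<rat>. \<forall>w\<in>K. \<exists>a\<in>\<rat>. \<exists>b\<in>\<rat>. w = a + b * x)"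

lemma rational_planeD:
  assumes "rational_plane K"
  shows "r \<in> \<rat> \<Longrightarrow> r \<in> K" "x \<in> K \<Longrightarrow> y \<in> K \<Longrightarrow> x * y \<in> K" "x \<in> K \<Longrightarrow> inverse x \<in> K"
  using assms unfolding rational_plane_def by auto

lemma rational_planeE:
  fixes x :: "'a::field_char_0"
  assumes "rational_plane K" "x \<in> K" "x \<notin> \<rat>" "w \<in> K"
  obtains a b where "w = of_rat a + of_rat b * x"
proof -
  have "\<exists>a\<in>\<rat>. \<exists>b\<in>\<rat>. w = a + b * x" using assms unfolding rational_plane_def by blast
  then show ?thesis using that by (metis Rats_cases)
qed

definition on_curve :: "'a::field_char_0 \<Rightarrow> 'a \<Rightarrow> 'a \<Rightarrow> bool" where
  "on_curve x y z \<longleftrightarrow> y ^ 2 = 2 * (x ^ 3 + x ^ 2 - x + 1) \<and>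
     z ^ 2 = 2 * x * (x ^ 3 + x ^ 2 + x - 1)"

lemma on_curve_involution:
  fixes x :: "'a::field_char_0"
  assumes "on_curve x y z" "x \<noteq> 0"
  shows "(z / x ^ 2) ^ 2 = 2 * ((- 1 / x) ^ 3 + (- 1 / x) ^ 2 - (- 1 / x) + 1)"
  using assms unfolding on_curve_def
  by (simp add: power_divide field_simps eval_nat_numeral)

lemma irrational_curve_point:
  fixes x :: "'a::field_char_0"
  assumes K: "rational_plane K" and xyz: "x \<in> K" "y \<in> K" "z \<in> K" "on_curve x y z" and x: "x \<notin> \<rat>"
  shows "x ^ 2 - 8 * x - 1 = 0"
proof -
  have "x * x \<in> K" using rational_planeD(2)[OF K] xyz by blast
  then obtain q' p' where "x * x = of_rat q' + of_rat p' * x"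
    using rational_planeE[OF K xyz(1) x] by blast
  then obtain p q where pq: "x ^ 2 + of_rat p * x + of_rat q = 0"
    by (intro that[of "- p'" "- q'"]) (simp add: of_rat_minus power2_eq_square)
  have x0: "x \<noteq> 0" using x by auto
  have q: "q \<noteq> 0"
  proof
    assume "q = 0"
    then have "x * (x + of_rat p) = 0" using pq by (simp add: power2_eq_square algebra_simps)
    then have "x = of_rat (- p)" using x0 by (simp add: of_rat_minus eq_neg_iff_add_eq_0)
    then show False using x by simp
  qed
  obtain \<beta> \<alpha> where y: "y = of_rat \<beta> + of_rat \<alpha> * x"
    using rational_planeE[OF K xyz(1) x xyz(2)] .
  have A: "(3 - p - q) ^ 2 = 16 - 8 * p \<or> (p - q - 1) ^ 2 = - 8 * p"
    using irrational_point_on_E_field[OF x pq y] xyz(4) unfolding on_curve_def by blast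
  define u v where "u = - 1 / x" and "v = z / x ^ 2"
  have xu: "x = - 1 / u" using x0 unfolding u_def by simp
  have u: "u \<notin> \<rat>" using x unfolding xu by (metis Rats_divide Rats_minus_iff Rats_1)
  have invK: "inverse x \<in> K" using rational_planeD(3)[OF K] xyz(1) .
  have "u = (-1) * inverse x" unfolding u_def by (simp add: field_simps)
  moreover have "-1 \<in> K" using rational_planeD(1)[OF K, of "-1"] by simp
  ultimately have uK: "u \<in> K" using rational_planeD(2)[OF K] invK by metis
  have "v = z * (inverse x * inverse x)" unfolding v_def by (simp add: field_simps power2_eq_square)
  then have vK: "v \<in> K" using rational_planeD(2)[OF K] invK xyz(3) by metis
  obtain \<delta> \<gamma> where v: "v = of_rat \<delta> + of_rat \<gamma> * u"
    using rational_planeE[OF K uK u vK] .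
  have upq: "u ^ 2 + of_rat (- p / q) * u + of_rat (1 / q) = 0"
  proof -
    have Q: "of_rat q \<noteq> (0 :: 'a)" using q by simp
    have "of_rat q * x ^ 2 * (u ^ 2 + of_rat (- p / q) * u + of_rat (1 / q)) = x ^ 2 + of_rat p * x + of_rat q"
      unfolding u_def using Q x0 by (simp add: of_rat_divide of_rat_minus field_simps power2_eq_square)
    then show ?thesis using pq Q x0 by simp
  qed
  have "(3 - - p / q - 1 / q) ^ 2 = 16 - 8 * (- p / q) \<or> (- p / q - 1 / q - 1) ^ 2 = - 8 * (- p / q)"
    using irrational_point_on_E_field[OF u upq v] on_curve_involution[OF xyz(4) x0]
    unfolding u_def v_def by blast
  then have "(3 * q + p - 1) ^ 2 = 16 * q ^ 2 + 8 * p * q \<or> (p + q + 1) ^ 2 = 8 * p * q"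
  proof (elim disjE)
    assume h: "(3 - - p / q - 1 / q) ^ 2 = 16 - 8 * (- p / q)"
    have "3 * q + p - 1 = q * (3 - - p / q - 1 / q)" using q by (simp add: right_diff_distrib distrib_left)
    then have "(3 * q + p - 1) ^ 2 = q ^ 2 * (16 - 8 * (- p / q))"
      by (simp only: power_mult_distrib h)
    also have "\<dots> = 16 * q ^ 2 + 8 * p * q" using q by (simp add: right_diff_distrib distrib_left power2_eq_square)
    finally show ?thesis ..
  next
    assume h: "(- p / q - 1 / q - 1) ^ 2 = - 8 * (- p / q)"
    have "- (p + q + 1) = q * (- p / q - 1 / q - 1)" using q by (simp add: right_diff_distrib distrib_left)
    then have "(- (p + q + 1)) ^ 2 = q ^ 2 * (- 8 * (- p / q))"
      by (simp only: power_mult_distrib h)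
    also have "\<dots> = 8 * p * q" using q by (simp add: power2_eq_square)
    finally show ?thesis by (simp only: power2_minus disj_comms) simp
  qed
  from matching_quadratics[OF A this q] show ?thesis
  proof (elim disjE conjE)
    assume "p = - 8" "q = - 1"
    then show ?thesis using pq by (simp add: of_rat_minus)
  next
    assume "p = 0" "q = - 1"
    then have "(x - 1) * (x + 1) = 0" using pq by (simp add: of_rat_minus power2_eq_square algebra_simps)
    then have "x = 1 \<or> x = -1" by (simp add: eq_neg_iff_add_eq_0)
    then show ?thesis using x by auto
  next
    assume "p = 2" "q = 1"
    then have "(x + 1) ^ 2 = 0" using pq by (simp add: power2_eq_square algebra_simps)
    then have "x = -1" by (simp add: eq_neg_iff_add_eq_0)
    then show ?thesis using x by auto
  next
    assume "p = - 2" "q = 1"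
    then have "(x - 1) ^ 2 = 0" using pq by (simp add: of_rat_minus power2_eq_square algebra_simps)
    then have "x = 1" by simp
    then show ?thesis using x by auto
  qed
qed

lemma on_curve_1:
  fixes x :: "'a::field_char_0"
  assumes "x = 1 \<or> x = -1"
  shows "on_curve x y z \<longleftrightarrow> y \<in> {2, -2} \<and> z \<in> {2, -2}"
proof -
  have "w ^ 2 = 4 \<longleftrightarrow> w \<in> {2, -2}" for w :: 'a
    using power2_eq_iff[of w 2] by simp
  moreover have "on_curve x y z \<longleftrightarrow> y ^ 2 = 4 \<and> z ^ 2 = 4"
    using assms unfolding on_curve_def by (elim disjE) simp_all
  ultimately show ?thesis by blast
qed

lemma rational_curve_point:
  fixes x :: "'a::field_char_0"
  assumes K: "rational_plane K" and xyz: "x \<in> K" "y \<in> K" "z \<in> K" "on_curve x y z" and x: "x \<in> \<rat>"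
  shows "x = 1 \<or> x = -1 \<or> x = 0 \<and> y ^ 2 = 2 \<and> z = 0"
proof (cases "x = 0 \<or> y \<in> \<rat> \<or> z \<in> \<rat>")
  case True
  consider "x = 0" | "y \<in> \<rat>" | "x \<noteq> 0" "z \<in> \<rat>" using True by blast
  then show ?thesis
  proof cases
    case 1
    then show ?thesis using xyz(4) unfolding on_curve_def by simp
  next
    case 2
    then show ?thesis using E_Rats_points x xyz(4) unfolding on_curve_def by blast
  next
    case 3
    then have "z / x ^ 2 \<in> \<rat>" "- 1 / x \<in> \<rat>" using x by simp_all
    then have "- 1 / x = 1 \<or> - 1 / x = -1"
      using E_Rats_points on_curve_involution[OF xyz(4) 3(1)] by blast
    then show ?thesis using 3(1) by (auto simp: field_simps)
  qed
next
  case False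
  \<comment> \<open>y and z are irrational with rational squares, so comparing coefficients in z^2 =
    (s + t y)^2 kills s.\<close>
  obtain s t where st: "z = of_rat s + of_rat t * y"
    using rational_planeE[OF K xyz(2) _ xyz(3)] False by blast
  obtain r where r: "x = of_rat r" using x by (auto elim: Rats_cases)
  define f g where "f = r ^ 3 + r ^ 2 - r + 1" and "g = r * (r ^ 3 + r ^ 2 + r - 1)"
  have y2: "y ^ 2 = of_rat (2 * f)" and z2: "z ^ 2 = of_rat (2 * g)"
    using xyz(4) unfolding on_curve_def r f_def g_def by (simp_all add: of_rat_hom)
  have "of_rat (s ^ 2 + t ^ 2 * (2 * f) - 2 * g) + of_rat (2 * s * t) * y = 0"
  proof -
    have "z ^ 2 = of_rat (s ^ 2) + of_rat (t ^ 2) * y ^ 2 + of_rat (2 * s * t) * y"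
      unfolding st by (simp add: of_rat_hom power2_eq_square algebra_simps)
    then show ?thesis unfolding y2 z2 by (simp add: of_rat_hom)
  qed
  from Rats_independent[OF _ _ _ this] False
  have 1: "s ^ 2 + t ^ 2 * (2 * f) - 2 * g = 0" and 2: "s = 0 \<or> t = 0" by auto
  have "t \<noteq> 0" using st False by auto
  then have "t ^ 2 * f = g" using 1 2 by simp
  moreover have "r \<noteq> 0" using False r by auto
  \<comment> \<open>A rational square root of y^2 contradicts the irrationality of y.\<close>
  ultimately obtain y' where "y' ^ 2 = 2 * f"
    using twisted_square[of t r] unfolding f_def g_def by blast
  then have "y ^ 2 = of_rat y' ^ 2" unfolding y2 by (metis of_rat_power)
  then have "y = of_rat y' \<or> y = - of_rat y'" by (simp add: power2_eq_iff)
  then show ?thesis using False by auto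
qed

section \<open>Quadratic fields as subfields of the ambient ring\<close>

lemma self_in_rat_adjoin: "r \<in> rat_adjoin r"
  unfolding rat_adjoin_def by (rule generate_field.incl) simp

context
  fixes R :: "'a::field_char_0 ring"
  defines "R \<equiv> ring_of_type_algebra"
begin

lemma R_simps: "carrier R = UNIV" "x \<otimes>\<^bsub>R\<^esub> y = x * y" "x \<oplus>\<^bsub>R\<^esub> y = x + y" "\<one>\<^bsub>R\<^esub> = 1" "\<zero>\<^bsub>R\<^esub> = 0"
  unfolding R_def ring_of_type_algebra_def by simp_all

interpretation R: Ring.field R
  unfolding R_def by (rule field_from_type_algebra)

lemma R_a_inv: "\<ominus>\<^bsub>R\<^esub> x = - x"
  by (rule R.minus_equality) (simp_all add: R_simps)

lemma R_m_inv: "x \<noteq> 0 \<Longrightarrow> inv\<^bsub>R\<^esub> x = inverse x"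
  by (rule R.comm_inv_char) (simp_all add: R_simps)

lemma subfield_closed:
  assumes "subfield K R"
  shows "1 \<in> K" "x \<in> K \<Longrightarrow> y \<in> K \<Longrightarrow> x + y \<in> K" "x \<in> K \<Longrightarrow> y \<in> K \<Longrightarrow> x * y \<in> K"
    "x \<in> K \<Longrightarrow> - x \<in> K" "x \<in> K \<Longrightarrow> inverse x \<in> K" "\<rat> \<subseteq> K"
proof -
  note sub = subringE[OF subfieldE(1)[OF assms], unfolded R_simps R_a_inv]
  have one: "1 \<in> K" using sub by blast
  have add: "x + y \<in> K" if "x \<in> K" "y \<in> K" for x y using sub that by blast
  have mult: "x * y \<in> K" if "x \<in> K" "y \<in> K" for x y using sub that by blast
  have minus: "- x \<in> K" if "x \<in> K" for x using sub that by blast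
  have inv: "inverse x \<in> K" if "x \<in> K" for x
  proof (cases "x = 0")
    case False
    then show ?thesis using R.subfield_m_inv(1)[OF assms, of x] that by (simp add: R_simps R_m_inv)
  qed (use that in simp)
  have nat: "of_nat n \<in> K" for n
    by (induction n) (use sub(2) one add in auto)
  have int: "of_int i \<in> K" for i
    using nat minus by (cases i) (auto simp flip: of_nat_Suc simp del: of_nat_Suc)
  have "\<rat> \<subseteq> K"
  proof
    fix r :: 'a assume "r \<in> \<rat>"
    then obtain a b where "r = of_int a / of_int b" by (rule Rats_cases')
    then have "r = of_int a * inverse (of_int b)" by (simp add: field_simps)
    then show "r \<in> K" using int mult inv by metis
  qed
  with one add mult minus inv show "1 \<in> K" "x \<in> K \<Longrightarrow> y \<in> K \<Longrightarrow> x + y \<in> K"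
    "x \<in> K \<Longrightarrow> y \<in> K \<Longrightarrow> x * y \<in> K" "x \<in> K \<Longrightarrow> - x \<in> K" "x \<in> K \<Longrightarrow> inverse x \<in> K" "\<rat> \<subseteq> K"
    by blast+
qed

lemma subfield_Rats: "subfield \<rat> R"
proof (intro R.subfieldI')
  show "subring \<rat> R"
    by (rule R.subringI) (simp_all add: R_simps R_a_inv)
qed (auto simp add: R_simps R_m_inv)

lemma rational_planeI:
  assumes "subfield K R"
    and "\<And>x w. x \<in> K \<Longrightarrow> x \<notin> \<rat> \<Longrightarrow> w \<in> K \<Longrightarrow> \<exists>a\<in>\<rat>. \<exists>b\<in>\<rat>. w = a + b * x"
  shows "rational_plane K"
  unfolding rational_plane_def
proof (intro conjI ballI)
  show "\<rat> \<subseteq> K" by (rule subfield_closed[OF assms(1)])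
next
  fix x y assume "x \<in> K" "y \<in> K"
  then show "x * y \<in> K" by (rule subfield_closed[OF assms(1)])
next
  fix x assume "x \<in> K"
  then show "inverse x \<in> K" by (rule subfield_closed[OF assms(1)])
next
  fix x w assume "x \<in> K - \<rat>" "w \<in> K"
  then show "\<exists>a\<in>\<rat>. \<exists>b\<in>\<rat>. w = a + b * x" using assms(2) by simp
qed

lemma quadratic_field_plane:
  assumes "subfield K R" "ring.dimension R 2 \<rat> K"
  shows "rational_plane K"
proof -
  have "ring.dimension R (Suc (Suc 0)) \<rat> K" using assms(2) by (simp add: numeral_2_eq_2)
  then obtain v E1 where "ring.dimension R (Suc 0) \<rat> E1" and K: "K = R.line_extension \<rat> v E1"
    using R.dimension_backwards[OF subfield_Rats] by blast
  then obtain w E0 where "ring.dimension R 0 \<rat> E0" and E1: "E1 = R.line_extension \<rat> w E0"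
    using R.dimension_backwards[OF subfield_Rats] by blast
  then have E0: "E0 = {0}" using R.dimension_zero[OF subfield_Rats] by (simp add: R_simps)
  have K_iff: "u \<in> K \<longleftrightarrow> (\<exists>a\<in>\<rat>. \<exists>b\<in>\<rat>. u = a * v + b * w)" for u
    unfolding K E1 E0 by (simp add: R.line_extension_mem_iff R_simps Bex_def) blast
  show ?thesis
  proof (rule rational_planeI[OF assms(1)])
    fix x u assume x: "x \<in> K" "x \<notin> \<rat>" and u: "u \<in> K"
    obtain a1 b1 where 1: "a1 \<in> \<rat>" "b1 \<in> \<rat>" "1 = a1 * v + b1 * w"
      using subfield_closed(1)[OF assms(1)] K_iff by blast
    obtain a2 b2 where 2: "a2 \<in> \<rat>" "b2 \<in> \<rat>" "x = a2 * v + b2 * w"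
      using x(1) K_iff by blast
    obtain a3 b3 where 3: "a3 \<in> \<rat>" "b3 \<in> \<rat>" "u = a3 * v + b3 * w"
      using u K_iff by blast
    \<comment> \<open>Cramer's rule: \<open>d\<close> is the determinant of 1 and x in the basis v,
      w. It is nonzero because x is irrational, and the other two determinants give the coordinates
      of u.\<close>
    define d where "d = a1 * b2 - a2 * b1"
    have "d \<noteq> 0"
    proof
      assume "d = 0"
      moreover have "a1 * x - a2 = d * w"
      proof -
        have "a1 * x - a2 * 1 = d * w"
          unfolding 1(3) 2(3) d_def by (simp add: algebra_simps)
        then show ?thesis by simp
      qed
      moreover have "b1 * x - b2 * 1 = - d * v"
        unfolding 1(3) 2(3) d_def by (simp add: algebra_simps)
      ultimately have "a1 * x = a2" "b1 * x = b2" by simp_all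
      moreover have "a1 \<noteq> 0 \<or> b1 \<noteq> 0" using 1(3) by auto
      ultimately have "x = a2 / a1 \<or> x = b2 / b1" by (auto simp: field_simps)
      then show False using x(2) 1 2 by auto
    qed
    define e f where "e = a3 * b2 - b3 * a2" and "f = a1 * b3 - b1 * a3"
    have "d * u = e * 1 + f * x"
      unfolding 1(3) 2(3) 3(3) d_def e_def f_def by (simp add: algebra_simps)
    then have "u = e / d + f / d * x"
      using \<open>d \<noteq> 0\<close> by (simp add: field_simps)
    moreover have "d \<in> \<rat>" "e \<in> \<rat>" "f \<in> \<rat>" unfolding d_def e_def f_def using 1 2 3 by simp_all
    ultimately show "\<exists>a\<in>\<rat>. \<exists>b\<in>\<rat>. u = a + b * x"
      by (intro bexI[of _ "e / d"] bexI[of _ "f / d"]) simp_all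
  qed
qed

lemma rat_adjoin_eq:
  fixes r :: 'a
  assumes r: "r \<notin> \<rat>" "r ^ 2 \<in> \<rat>"
  shows "rat_adjoin r = {a + b * r | a b. a \<in> \<rat> \<and> b \<in> \<rat>}" and "subfield (rat_adjoin r) R"
proof -
  show sub: "subfield (rat_adjoin r) R"
    unfolding rat_adjoin_def R_def[symmetric] by (rule R.generate_field_is_subfield) (simp add: R_simps)
  show "rat_adjoin r = {a + b * r | a b. a \<in> \<rat> \<and> b \<in> \<rat>}" (is "_ = ?S")
  proof
    show "?S \<subseteq> rat_adjoin r"
    proof
      fix w assume "w \<in> ?S"
      then obtain a b where ab: "a \<in> \<rat>" "b \<in> \<rat>" "w = a + b * r" by blast
      then have "a \<in> rat_adjoin r" "b \<in> rat_adjoin r" using subfield_closed(6)[OF sub] by auto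
      then show "w \<in> rat_adjoin r"
        unfolding ab(3) by (intro subfield_closed(2,3)[OF sub] self_in_rat_adjoin)
    qed
    show "rat_adjoin r \<subseteq> ?S"
    proof
      fix h assume "h \<in> rat_adjoin r"
      then have "h \<in> generate_field R {r}" unfolding rat_adjoin_def R_def .
      then show "h \<in> ?S"
      proof induction
        case one
        show ?case unfolding R_simps by (rule CollectI, rule exI[of _ 1], rule exI[of _ 0]) simp
      next
        case (incl h)
        then show ?case by (intro CollectI exI[of _ 0] exI[of _ 1]) simp
      next
        case (a_inv h)
        then obtain a b where "a \<in> \<rat>" "b \<in> \<rat>" "h = a + b * r" by blast
        then show ?case unfolding R_a_inv by (intro CollectI exI[of _ "- a"] exI[of _ "- b"]) simp
      next
        case (m_inv h)
        then obtain a b where ab: "a \<in> \<rat>" "b \<in> \<rat>" "h = a + b * r" by blast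
        have h: "h \<noteq> 0" using m_inv by (simp add: R_simps)
        define n where "n = a ^ 2 - b ^ 2 * r ^ 2"
        have n: "n = h * (a - b * r)" unfolding n_def ab(3) by (simp add: power2_eq_square algebra_simps)
        have "a - b * r \<noteq> 0"
        proof
          assume "a - b * r = 0"
          then have "a + (- b) * r = 0" by simp
          from Rats_independent[OF r(1) ab(1) _ this] ab have "a = 0" "b = 0" by simp_all
          then show False using h ab by simp
        qed
        then have "n \<noteq> 0" unfolding n using h by simp
        have inv: "inverse h = a / n + (- b / n) * r"
        proof -
          have "h * (a / n + (- b / n) * r) = h * (a - b * r) / n"
            using \<open>n \<noteq> 0\<close> by (simp add: field_simps)
          also have "\<dots> = 1" unfolding n[symmetric] using \<open>n \<noteq> 0\<close> by simp
          finally show ?thesis by (rule inverse_unique)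
        qed
        have "n \<in> \<rat>" unfolding n_def using ab r by simp
        then show ?case
          unfolding R_m_inv[OF h] inv using ab(1,2)
          by (intro CollectI exI[of _ "a / n"] exI[of _ "- b / n"]) simp
      next
        case (eng_add h1 h2)
        then obtain a b c d where *: "a \<in> \<rat>" "b \<in> \<rat>" "h1 = a + b * r" "c \<in> \<rat>" "d \<in> \<rat>" "h2 = c + d * r"
          by blast
        show ?case unfolding R_simps
          by (intro CollectI exI[of _ "a + c"] exI[of _ "b + d"]) (use * in \<open>simp add: algebra_simps\<close>)
      next
        case (eng_mult h1 h2)
        then obtain a b c d where *: "a \<in> \<rat>" "b \<in> \<rat>" "h1 = a + b * r" "c \<in> \<rat>" "d \<in> \<rat>" "h2 = c + d * r"
          by blast
        show ?case unfolding R_simps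
          by (intro CollectI exI[of _ "a * c + b * d * r ^ 2"] exI[of _ "a * d + b * c"])
            (use * r in \<open>simp add: algebra_simps power2_eq_square\<close>)
      qed
    qed
  qed
qed

lemma rat_adjoin_plane:
  fixes r :: 'a
  assumes r: "r \<notin> \<rat>" "r ^ 2 \<in> \<rat>"
  shows "rational_plane (rat_adjoin r)"
proof (rule rational_planeI[OF rat_adjoin_eq(2)[OF r]])
  fix x w assume x: "x \<in> rat_adjoin r" "x \<notin> \<rat>" and w: "w \<in> rat_adjoin r"
  obtain a b where ab: "a \<in> \<rat>" "b \<in> \<rat>" "x = a + b * r" using x rat_adjoin_eq(1)[OF r] by blast
  obtain a' b' where ab': "a' \<in> \<rat>" "b' \<in> \<rat>" "w = a' + b' * r" using w rat_adjoin_eq(1)[OF r] by blast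
  have "b \<noteq> 0" using x(2) ab by auto
  then have "w = (a' - b' * a / b) + (b' / b) * x"
    unfolding ab ab' by (simp add: field_simps)
  then show "\<exists>c\<in>\<rat>. \<exists>d\<in>\<rat>. w = c + d * x" using ab ab'
    by (intro bexI[of _ "a' - b' * a / b"] bexI[of _ "b' / b"]) simp_all
qed

lemma plane_eq_rat_adjoin:
  fixes r :: 'a
  assumes "subfield K R" "rational_plane K" "r \<in> K" "r \<notin> \<rat>" "r ^ 2 \<in> \<rat>"
  shows "K = rat_adjoin r"
proof
  note eq = rat_adjoin_eq(1)[OF assms(4,5)]
  show "K \<subseteq> rat_adjoin r"
  proof
    fix w assume "w \<in> K"
    then obtain a b where "w = of_rat a + of_rat b * r" using rational_planeE assms(2-4) by metis
    then show "w \<in> rat_adjoin r" unfolding eq by force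
  qed
  show "rat_adjoin r \<subseteq> K"
  proof
    fix w assume "w \<in> rat_adjoin r"
    then obtain a b where ab: "a \<in> \<rat>" "b \<in> \<rat>" "w = a + b * r" unfolding eq by blast
    then have "a \<in> K" "b \<in> K" using subfield_closed(6)[OF assms(1)] by auto
    then show "w \<in> K"
      unfolding ab(3) by (intro subfield_closed(2,3)[OF assms(1)] assms(3))
  qed
qed

end

section \<open>Separating the two exceptional fields\<close>

lemma sqrt_not_Rats:
  fixes r :: "'a::field_char_0"
  assumes "r ^ 2 = 2 \<or> r ^ 2 = 17 \<or> r ^ 2 = 34"
  shows "r \<notin> \<rat>"
proof
  assume "r \<in> \<rat>"
  then obtain s where s: "r = of_rat s" by (rule Rats_cases)
  have "of_rat (s ^ 2) \<in> {of_rat 2, of_rat 17, of_rat 34 :: 'a}"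
    using assms unfolding s by (simp add: of_rat_power)
  then have "s ^ 2 = 2 \<or> s ^ 2 = 17 \<or> s ^ 2 = 34" by (simp only: of_rat_eq_iff insert_iff empty_iff simp_thms)
  then show False using no_rat_sqrt by blast
qed

lemma square_in_rat_adjoin:
  fixes r w :: "'a::field_char_0"
  assumes r: "r \<notin> \<rat>" "r ^ 2 \<in> \<rat>" and w: "w \<in> rat_adjoin r" "w \<notin> \<rat>" "w ^ 2 \<in> \<rat>"
  obtains b where "b \<in> \<rat>" "w ^ 2 = b ^ 2 * r ^ 2"
proof -
  obtain a b where ab: "a \<in> \<rat>" "b \<in> \<rat>" "w = a + b * r" using w(1) rat_adjoin_eq(1)[OF r] by blast
  have "(a ^ 2 + b ^ 2 * r ^ 2 - w ^ 2) + (2 * a * b) * r = 0"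
    unfolding ab by (simp add: power2_eq_square algebra_simps)
  from Rats_independent(2)[OF r(1) _ _ this] have "a = 0 \<or> b = 0"
    using ab r w by simp
  moreover have "b \<noteq> 0" using w(2) ab by auto
  ultimately show ?thesis using that[OF ab(2)] ab(3) by (simp add: power_mult_distrib)
qed

text \<open>If w lay in \<open>rat_adjoin r\<close>, it would be b r up to sign with b rational, and
  r^2 b would be a rational square root of 34.\<close>

lemma sqrt_fields_distinct:
  fixes r w :: "'a::field_char_0"
  assumes "r ^ 2 = 2 \<and> w ^ 2 = 17 \<or> r ^ 2 = 17 \<and> w ^ 2 = 2"
  shows "w \<notin> rat_adjoin r"
proof
  assume w: "w \<in> rat_adjoin r"
  have rw: "r \<notin> \<rat>" "w \<notin> \<rat>" using assms sqrt_not_Rats by blast+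
  moreover have "r ^ 2 \<in> \<rat>" "w ^ 2 \<in> \<rat>" using assms by auto
  ultimately obtain b where b: "b \<in> \<rat>" "w ^ 2 = b ^ 2 * r ^ 2"
    using square_in_rat_adjoin w by metis
  have "(r ^ 2 * b) ^ 2 = r ^ 2 * w ^ 2" unfolding b(2) by (simp add: power2_eq_square mult_ac)
  also have "\<dots> = 34" using assms by auto
  finally have "r ^ 2 * b \<notin> \<rat>" using sqrt_not_Rats by blast
  then show False using b(1) \<open>r ^ 2 \<in> \<rat>\<close> by simp
qed

lemma curve_points_iff:
  "(x, y, z) \<in> curve_points K \<longleftrightarrow> x \<in> K \<and> y \<in> K \<and> z \<in> K \<and> on_curve x y z"
  unfolding curve_points_def on_curve_def by simp

lemma curve_points_Rats: "curve_points (\<rat> :: 'a::field_char_0 set) = {1, -1} \<times> {2, -2} \<times> {2, -2}"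
proof -
  have eq: "(x, y, z) \<in> curve_points \<rat> \<longleftrightarrow> x \<in> {1, -1} \<and> y \<in> {2, -2} \<and> z \<in> {2, -2}" for x y z :: 'a
  proof
    assume *: "(x, y, z) \<in> curve_points \<rat>"
    then have "x = 1 \<or> x = -1"
      unfolding curve_points_iff on_curve_def using E_Rats_points by blast
    then show "x \<in> {1, -1} \<and> y \<in> {2, -2} \<and> z \<in> {2, -2}"
      using * on_curve_1 unfolding curve_points_iff by blast
  next
    assume *: "x \<in> {1, -1} \<and> y \<in> {2, -2} \<and> z \<in> {2, -2}"
    then have "on_curve x y z" using on_curve_1[of x y z] by blast
    moreover have "x \<in> \<rat>" "y \<in> \<rat>" "z \<in> \<rat>" using * by auto
    ultimately show "(x, y, z) \<in> curve_points \<rat>" unfolding curve_points_iff by blast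
  qed
  show ?thesis
  proof (rule Set.set_eqI)
    fix p :: "'a \<times> 'a \<times> 'a"
    obtain x y z where p: "p = (x, y, z)" by (cases p)
    show "p \<in> curve_points \<rat> \<longleftrightarrow> p \<in> {1, -1} \<times> {2, -2} \<times> {2, -2}"
      unfolding p mem_Sigma_iff by (rule eq)
  qed
qed

lemma curve_point_cases:
  fixes x :: "'a::field_char_0"
  assumes "rational_plane K" "(x, y, z) \<in> curve_points K"
  shows "(x, y, z) \<in> curve_points \<rat> \<or> x = 0 \<and> y ^ 2 = 2 \<and> z = 0 \<or> x ^ 2 - 8 * x - 1 = 0"
proof (cases "x \<in> \<rat>")
  case False
  then show ?thesis using irrational_curve_point[OF assms(1)] assms(2) unfolding curve_points_iff by blast
next
  case True
  then have "x = 1 \<or> x = -1 \<or> x = 0 \<and> y ^ 2 = 2 \<and> z = 0"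
    using rational_curve_point[OF assms(1)] assms(2) unfolding curve_points_iff by blast
  then show ?thesis
    using on_curve_1[of x y z] assms(2) unfolding curve_points_Rats curve_points_iff by blast
qed

lemma sqrt_17_points:
  fixes x :: "'a::field_char_0"
  assumes "x ^ 2 - 8 * x - 1 = 0"
  shows "(x - 4) ^ 2 = 17"
    "on_curve x y z \<longleftrightarrow> y \<in> {4 * x + 2, - (4 * x + 2)} \<and> z \<in> {12 * x + 2, - (12 * x + 2)}"
proof -
  have x2: "x ^ 2 = 8 * x + 1" using assms by (simp add: algebra_simps)
  show "(x - 4) ^ 2 = 17" using assms by Groebner_Basis.algebra
  have "2 * (x ^ 3 + x ^ 2 - x + 1) = (4 * x + 2) ^ 2" using x2 by Groebner_Basis.algebra
  moreover have "2 * x * (x ^ 3 + x ^ 2 + x - 1) = (12 * x + 2) ^ 2" using x2 by Groebner_Basis.algebra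
  ultimately show "on_curve x y z \<longleftrightarrow> y \<in> {4 * x + 2, - (4 * x + 2)} \<and> z \<in> {12 * x + 2, - (12 * x + 2)}"
    unfolding on_curve_def by (simp add: power2_eq_iff)
qed

theorem theorem3p64:
  "curve_points (\<rat> :: 'a::field_char_0 set) = {1, -1} \<times> {2, -2} \<times> {2, -2} \<and>
   (\<forall>K :: 'a set. quadratic_field K \<and>
        (\<forall>r. r ^ 2 = 2 \<longrightarrow> K \<noteq> rat_adjoin r) \<and>
        (\<forall>r. r ^ 2 = 17 \<longrightarrow> K \<noteq> rat_adjoin r) \<longrightarrow>
      curve_points K = curve_points \<rat>) \<and>
   (\<forall>r :: 'a. r ^ 2 = 2 \<longrightarrow>
      curve_points (rat_adjoin r) - curve_points \<rat> = {(0, r, 0), (0, - r, 0)}) \<and>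
   (\<forall>r :: 'a. r ^ 2 = 17 \<longrightarrow>
      curve_points (rat_adjoin r) - curve_points \<rat> =
        {(x, y, z). x \<in> rat_adjoin r \<and> x ^ 2 - 8 * x - 1 = 0 \<and>
           y \<in> {4 * x + 2, - (4 * x + 2)} \<and> z \<in> {12 * x + 2, - (12 * x + 2)}})"
proof (intro conjI allI impI)
  show "curve_points (\<rat> :: 'a set) = {1, -1} \<times> {2, -2} \<times> {2, -2}"
    by (rule curve_points_Rats)
next
  fix K :: "'a set"
  assume K: "quadratic_field K \<and> (\<forall>r. r ^ 2 = 2 \<longrightarrow> K \<noteq> rat_adjoin r) \<and>
    (\<forall>r. r ^ 2 = 17 \<longrightarrow> K \<noteq> rat_adjoin r)"
  then have sub: "subfield K ring_of_type_algebra" and plane: "rational_plane K"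
    using quadratic_field_plane unfolding quadratic_field_def by blast+
  \<comment> \<open>The exceptional points put a square root of 2 (namely y) or of 17 (namely x - 4)
    into K, and one such element already determines K.\<close>
  have no_sqrt: "r \<notin> K" if "r ^ 2 = 2 \<or> r ^ 2 = 17" for r
  proof
    assume "r \<in> K"
    moreover have "r \<notin> \<rat>" "r ^ 2 \<in> \<rat>" using that sqrt_not_Rats by auto
    ultimately have "K = rat_adjoin r" using plane_eq_rat_adjoin[OF sub plane] by blast
    then show False using K that by blast
  qed
  show "curve_points K = curve_points \<rat>"
  proof
    show "curve_points \<rat> \<subseteq> curve_points K"
      using rational_planeD(1)[OF plane] unfolding curve_points_def by auto
    show "curve_points K \<subseteq> curve_points \<rat>"
    proof safe
      fix x y z assume P: "(x, y, z) \<in> curve_points K"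
      then have xy: "x \<in> K" "y \<in> K" unfolding curve_points_iff by blast+
      have "x - 4 \<in> K"
      proof -
        have "-4 \<in> K" using rational_planeD(1)[OF plane, of "-4"] by simp
        then show ?thesis using subfield_closed(2)[OF sub xy(1)] by fastforce
      qed
      then show "(x, y, z) \<in> curve_points \<rat>"
        using curve_point_cases[OF plane P] no_sqrt xy(2) sqrt_17_points(1) by blast
    qed
  qed
next
  fix r :: 'a assume r: "r ^ 2 = 2"
  then have rQ: "r \<notin> \<rat>" "r ^ 2 \<in> \<rat>" using sqrt_not_Rats by auto
  note plane = rat_adjoin_plane[OF rQ]
  note closed = subfield_closed[OF rat_adjoin_eq(2)[OF rQ]]
  have in_K: "0 \<in> rat_adjoin r" "r \<in> rat_adjoin r" "- r \<in> rat_adjoin r"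
    using closed(4)[OF self_in_rat_adjoin] self_in_rat_adjoin rational_planeD(1)[OF plane Rats_0] by blast+
  show "curve_points (rat_adjoin r) - curve_points \<rat> = {(0, r, 0), (0, - r, 0)}"
  proof (intro equalityI subsetI)
    fix P assume P: "P \<in> curve_points (rat_adjoin r) - curve_points \<rat>"
    obtain x y z where xyz: "P = (x, y, z)" by (cases P)
    have "x ^ 2 - 8 * x - 1 \<noteq> 0"
    proof
      assume "x ^ 2 - 8 * x - 1 = 0"
      then have "(x - 4) ^ 2 = 17" by (rule sqrt_17_points)
      then have "x - 4 \<notin> rat_adjoin r" using sqrt_fields_distinct r by blast
      moreover have "x \<in> rat_adjoin r" using P unfolding xyz Diff_iff curve_points_iff by blast
      then have "x + (- 4) \<in> rat_adjoin r"
        by (rule closed(2)) (rule rational_planeD(1)[OF plane], simp)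
      ultimately show False by simp
    qed
    then have "x = 0" "y ^ 2 = r ^ 2" "z = 0"
      using curve_point_cases[OF plane, of x y z] P r unfolding xyz by auto
    then show "P \<in> {(0, r, 0), (0, - r, 0)}" unfolding xyz by (simp add: power2_eq_iff)
  next
    fix P :: "'a \<times> 'a \<times> 'a" assume "P \<in> {(0, r, 0), (0, - r, 0)}"
    then show "P \<in> curve_points (rat_adjoin r) - curve_points \<rat>"
      unfolding curve_points_Rats using in_K r by (auto simp: curve_points_def)
  qed
next
  fix r :: 'a assume r: "r ^ 2 = 17"
  then have rQ: "r \<notin> \<rat>" "r ^ 2 \<in> \<rat>" using sqrt_not_Rats by auto
  note plane = rat_adjoin_plane[OF rQ]
  note closed = subfield_closed[OF rat_adjoin_eq(2)[OF rQ]]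
  have num: "2 \<in> rat_adjoin r" "4 \<in> rat_adjoin r" "12 \<in> rat_adjoin r"
    by (auto intro: rational_planeD(1)[OF plane])
  have eq: "(x, y, z) \<in> curve_points (rat_adjoin r) - curve_points \<rat> \<longleftrightarrow>
      x \<in> rat_adjoin r \<and> x ^ 2 - 8 * x - 1 = 0 \<and>
      y \<in> {4 * x + 2, - (4 * x + 2)} \<and> z \<in> {12 * x + 2, - (12 * x + 2)}" for x y z
  proof
    assume P: "(x, y, z) \<in> curve_points (rat_adjoin r) - curve_points \<rat>"
    then have xyz: "x \<in> rat_adjoin r" "y \<in> rat_adjoin r" "on_curve x y z"
      unfolding Diff_iff curve_points_iff by blast+
    have "y ^ 2 \<noteq> 2" using sqrt_fields_distinct[of r y] r xyz(2) by blast
    then have x: "x ^ 2 - 8 * x - 1 = 0" using curve_point_cases[OF plane] P by blast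
    then show "x \<in> rat_adjoin r \<and> x ^ 2 - 8 * x - 1 = 0 \<and>
      y \<in> {4 * x + 2, - (4 * x + 2)} \<and> z \<in> {12 * x + 2, - (12 * x + 2)}"
      using xyz sqrt_17_points(2) by blast
  next
    assume *: "x \<in> rat_adjoin r \<and> x ^ 2 - 8 * x - 1 = 0 \<and>
      y \<in> {4 * x + 2, - (4 * x + 2)} \<and> z \<in> {12 * x + 2, - (12 * x + 2)}"
    then have "on_curve x y z" using sqrt_17_points(2) by blast
    moreover have "4 * x + 2 \<in> rat_adjoin r" "12 * x + 2 \<in> rat_adjoin r"
      using * num closed(2,3) by blast+
    then have "y \<in> rat_adjoin r" "z \<in> rat_adjoin r" using * closed(4) by blast+
    moreover have "x \<noteq> 1" "x \<noteq> -1" using * by auto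
    ultimately show "(x, y, z) \<in> curve_points (rat_adjoin r) - curve_points \<rat>"
      using * unfolding curve_points_Rats curve_points_iff[of x y z "rat_adjoin r"] Diff_iff by blast
  qed
  show "curve_points (rat_adjoin r) - curve_points \<rat> =
        {(x, y, z). x \<in> rat_adjoin r \<and> x ^ 2 - 8 * x - 1 = 0 \<and>
           y \<in> {4 * x + 2, - (4 * x + 2)} \<and> z \<in> {12 * x + 2, - (12 * x + 2)}}"
  proof (rule Set.set_eqI)
    fix p :: "'a \<times> 'a \<times> 'a"
    obtain x y z where p: "p = (x, y, z)" by (cases p)
    show "p \<in> curve_points (rat_adjoin r) - curve_points \<rat> \<longleftrightarrow>
      p \<in> {(x, y, z). x \<in> rat_adjoin r \<and> x ^ 2 - 8 * x - 1 = 0 \<and>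
           y \<in> {4 * x + 2, - (4 * x + 2)} \<and> z \<in> {12 * x + 2, - (12 * x + 2)}}"
      unfolding p mem_Collect_eq case_prod_conv by (rule eq)
  qed
qed

end
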